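(* In the weighted Indian buffet model described in the context, suppose $\beta\in[0,1)$ and $\overline{R}_n:=\frac1n\sum_{i=1}^nR_i\to r$ almost surely for some constant $r$. Let $L_n=\mathrm{card}(S_n)$. Then \[ \frac{L_n}{a_n(\beta)}\longrightarrow\lambda(\beta)\quad\text{almost surely}, \] where $a_n(\beta)=\log n$ and $\lambda(\beta)=\alpha c/r$ if $\beta=0$, while $a_n(\beta)=n^\beta$ and $\lambda(\beta)=\frac{\alpha\Gamma(c+1)}{\Gamma(c+\beta)}\frac{1}{\beta r^{1-\beta}}$ if $\beta\in(0,1)$.
   Context: Let $\mathcal{X}$ be a separable metric space with Borel $\sigma$-field $\mathcal{B}$, and let $\mathcal{M}$ be the set of finite positive measures on $\mathcal{B}$; $\mu\in\mathcal{M}$ is diffuse if $\mu\{x\}=0$ for all $x$. All random quantities live on a probability space $(\Omega,\mathcal{A},P)$. A random measure (r.m.) is a map $M:\Omega\to\mathcal{M}$ such that $\omega\mapsto M(\omega)(B)$ is measurable for each $B\in\mathcal{B}$. A Poisson r.m. with intensity $\nu\in\mathcal{M}$ is an r.m. $M$ with $M(B_1),\dots,M(B_k)$ independent for pairwise disjoint $B_j$ and $M(B)\sim\mathrm{Poi}(\nu(B))$ for all $B$ (with $\mathrm{Poi}(0)=\delta_0$). Each $\nu\in\mathcal{M}$ is uniquely $\nu=\nu_c+\nu_d$, $\nu_c$ diffuse, $\nu_d=\sum_j\gamma_j\delta_{x_j}$. $M\sim\mathrm{BeP}(\nu)$ (Bernoulli r.m. with hazard measure $\nu$) means $M=M_1+M_2$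 with $M_1,M_2$ independent, $M_1$ Poisson with intensity $\nu_c$, $M_2=\sum_jV_j\delta_{x_j}$ with independent indicators $V_j$, $P(V_j=1)=\gamma_j$. "$X\mid\mathcal{G}\sim Y\mid\mathcal{G}$" means $P(X\in A\mid\mathcal{G})=P(Y\in A\mid\mathcal{G})$ a.s. for all measurable $A$. Model: fix a diffuse probability measure $m$ on $\mathcal{B}$ and reals $\alpha>0$, $\beta<1$, $c>-\beta$. $(M_n)_{n\ge1}$ are r.m.'s and $(R_n)_{n\ge1}$ real random variables such that for each $n\ge1$, $R_n$ is independent of $(M_1,\dots,M_n,R_1,\dots,R_{n-1})$ and $R_n\ge u$ for a constant $u>\max(\beta,0)$; and $M_{n+1}\mid\mathcal{F}_n\sim\mathrm{BeP}(\nu_n)$ for all $n\ge0$, where $\mathcal{F}_0=\{\varnothing,\Omega\}$, $\mathcal{F}_n=\sigma(M_1,\dots,M_n,R_1,\dots,R_n)$, $S_n=\{x: M_i\{x\}=1\text{ for some } i\le n\}$, $\nu_0=\alpha m$ and for $n\ge1$ \[ \nu_n=\sum_{x\in S_n}\frac{\sum_{i=1}^nR_iM_i\{x\}-\beta}{\sum_{i=1}^nR_i+c}\,\delta_x+\Lambda_n\, m,\qquad \Lambda_0=\alpha,\ \ \Lambda_n=\alpha\frac{\Gamma(c+1)\Gamma(c+\beta+\sum_{i=1}^nR_i)}{\Gamma(c+\beta)\Gamma(c+1+\sum_{i=1}^nR_i)}. \] *)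

theory Defs
  imports "HOL-Probability.Probability"
begin

(* (Same construction as subprob_algebra in the Giry monad theory.)    *)
definition FM :: "'x::topological_space measure measure" where
  "FM = (SUP B \<in> sets (borel :: 'x measure).
          vimage_algebra {N. finite_measure N \<and> sets N = sets (borel :: 'x measure)}
            (\<lambda>N. emeasure N B) borel)"

definition random_measure :: "'w measure \<Rightarrow> ('w \<Rightarrow> 'x::topological_space measure) \<Rightarrow> bool" where
  "random_measure P N \<longleftrightarrow>
     (\<forall>\<omega>\<in>space P. finite_measure (N \<omega>) \<and> sets (N \<omega>) = sets (borel :: 'x measure)) \<and>
     (\<forall>B\<in>sets (borel :: 'x measure). (\<lambda>\<omega>. emeasure (N \<omega>) B) \<in> borel_measurable P)"

definition sum_dirac :: "nat \<Rightarrow> (nat \<Rightarrow> 'x::topological_space) \<Rightarrow> 'x measure" where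
  "sum_dirac k \<xi> = measure_of UNIV (sets borel) (\<lambda>A. of_nat (card {i. i < k \<and> \<xi> i \<in> A}))"

definition set_dirac :: "'x::topological_space set \<Rightarrow> 'x measure" where
  "set_dirac D = measure_of UNIV (sets borel)
     (\<lambda>A. if finite D then of_nat (card (D \<inter> A)) else 0)"

definition add_meas :: "'x::topological_space measure \<Rightarrow> 'x measure \<Rightarrow> 'x measure" where
  "add_meas \<mu>1 \<mu>2 = measure_of UNIV (sets borel) (\<lambda>A. emeasure \<mu>1 A + emeasure \<mu>2 A)"

definition atoms :: "'x::topological_space measure \<Rightarrow> 'x set" where
  "atoms \<nu> = {x. emeasure \<nu> {x} > 0}"

definition diffuse_part :: "'x::topological_space measure \<Rightarrow> 'x measure" where
  "diffuse_part \<nu> = measure_of UNIV (sets borel) (\<lambda>A. emeasure \<nu> (A - atoms \<nu>))"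

definition Poi :: "real \<Rightarrow> nat pmf" where
  "Poi t = (if t = 0 then return_pmf 0 else poisson_pmf t)"

(* Law of a Poisson random measure with finite diffuse intensity mu:
   Poi(mu(X)) many i.i.d. points with law mu / mu(X). *)
definition poisson_rm_law :: "'x::topological_space measure \<Rightarrow> 'x measure measure" where
  "poisson_rm_law \<mu> =
     (let t = measure \<mu> UNIV;
          q = measure_of UNIV (sets borel) (\<lambda>A. emeasure \<mu> A / ennreal t)
      in measure_pmf (Poi t) \<bind>
           (\<lambda>k. distr (PiM {..<k} (\<lambda>_. q)) FM (\<lambda>\<xi>. sum_dirac k \<xi>)))"

definition atom_rm_law :: "'x::topological_space measure \<Rightarrow> 'x measure measure" where
  "atom_rm_law \<nu> =
     distr (PiM (atoms \<nu>) (\<lambda>x. measure_pmf (bernoulli_pmf (measure \<nu> {x})))) FM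
       (\<lambda>v. set_dirac {x \<in> atoms \<nu>. v x})"

definition BeP :: "'x::topological_space measure \<Rightarrow> 'x measure measure" where
  "BeP \<nu> = distr (poisson_rm_law (diffuse_part \<nu>) \<Otimes>\<^sub>M atom_rm_law \<nu>) FM
              (\<lambda>(\<mu>1, \<mu>2). add_meas \<mu>1 \<mu>2)"

definition cond_BeP :: "'w measure \<Rightarrow> 'w measure \<Rightarrow> ('w \<Rightarrow> 'x::topological_space measure)
    \<Rightarrow> ('w \<Rightarrow> 'x measure) \<Rightarrow> bool" where
  "cond_BeP P G X \<nu> \<longleftrightarrow>
     (\<forall>A\<in>sets FM. AE \<omega> in P.
        real_cond_exp P G (indicator {\<omega>\<in>space P. X \<omega> \<in> A}) \<omega> = measure (BeP (\<nu> \<omega>)) A)"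

definition gen_sigma :: "'w measure \<Rightarrow> (nat \<Rightarrow> 'w \<Rightarrow> 'x::topological_space measure)
    \<Rightarrow> (nat \<Rightarrow> 'w \<Rightarrow> real) \<Rightarrow> nat set \<Rightarrow> nat set \<Rightarrow> 'w measure" where
  "gen_sigma P Ms R I J = sigma (space P)
     ((\<Union>i\<in>I. {Ms i -` A \<inter> space P | A. A \<in> sets FM}) \<union>
      (\<Union>j\<in>J. {R j -` A \<inter> space P | A. A \<in> sets borel}))"

definition feat_set :: "(nat \<Rightarrow> 'w \<Rightarrow> 'x::topological_space measure) \<Rightarrow> nat \<Rightarrow> 'w \<Rightarrow> 'x set" where
  "feat_set Ms n \<omega> = {x. \<exists>i\<in>{1..n}. emeasure (Ms i \<omega>) {x} = 1}"

definition Lam :: "real \<Rightarrow> real \<Rightarrow> real \<Rightarrow> (nat \<Rightarrow> 'w \<Rightarrow> real) \<Rightarrow> nat \<Rightarrow> 'w \<Rightarrow> real" where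
  "Lam \<alpha> \<beta> c R n \<omega> =
     \<alpha> * (Gamma (c + 1) * Gamma (c + \<beta> + (\<Sum>i=1..n. R i \<omega>))) /
         (Gamma (c + \<beta>) * Gamma (c + 1 + (\<Sum>i=1..n. R i \<omega>)))"

(* nu_n = sum_{x in S_n} w_n(x) delta_x + Lambda_n m ;  for n = 0 this is alpha m *)
definition hazard :: "'x::topological_space measure \<Rightarrow> real \<Rightarrow> real \<Rightarrow> real
    \<Rightarrow> (nat \<Rightarrow> 'w \<Rightarrow> 'x measure) \<Rightarrow> (nat \<Rightarrow> 'w \<Rightarrow> real) \<Rightarrow> nat \<Rightarrow> 'w \<Rightarrow> 'x measure" where
  "hazard m \<alpha> \<beta> c Ms R n \<omega> = measure_of UNIV (sets borel)
     (\<lambda>A. (\<Sum>x\<in>feat_set Ms n \<omega> \<inter> A.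
             ennreal (((\<Sum>i=1..n. R i \<omega> * measure (Ms i \<omega>) {x}) - \<beta>) / ((\<Sum>i=1..n. R i \<omega>) + c)))
          + ennreal (Lam \<alpha> \<beta> c R n \<omega>) * emeasure m A)"

end

theory Submission
  imports Defs "HOL-Real_Asymp.Real_Asymp"
begin

text \<open>
  Given the past, the number of new features at step \<open>n + 1\<close> is Poisson with parameter \<open>\<Lambda>\<^sub>n\<close>, because
  it is the mass which \<open>M\<^sub>n\<^sub>+\<^sub>1\<close> puts off the atoms \<open>S\<^sub>n\<close> of \<open>\<nu>\<^sub>n\<close>, and \<open>M\<^sub>n\<^sub>+\<^sub>1\<close> almost surely has no
  multiple points there. Hence \<open>L\<^sub>n - \<Sum>\<^sub>j\<^sub><\<^sub>n \<Lambda>\<^sub>j\<close> is a square integrable martingale with variance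
  \<open>\<Sum>\<^sub>j\<^sub><\<^sub>n E \<Lambda>\<^sub>j\<close>, and \<open>R\<^sub>i \<ge> u\<close> bounds this by a multiple of \<open>a\<^sub>n\<close>. Along the indices where \<open>a\<^sub>n\<close> first
  reaches \<open>k\<^sup>2\<close> the variances of the martingale divided by \<open>a\<^sub>n\<close> are summable, so it converges to \<open>0\<close>
  there almost surely. Log-convexity of the Gamma function gives \<open>\<Gamma>(x) / \<Gamma>(x + 1 - \<beta>) \<sim> x\<^sup>\<beta>\<^sup>-\<^sup>1\<close>, and the
  Stolz--Cesaro theorem turns \<open>\<Sum>\<^sub>i\<^sub>\<le>\<^sub>n R\<^sub>i \<sim> r n\<close> into \<open>\<Sum>\<^sub>j\<^sub><\<^sub>n \<Lambda>\<^sub>j \<sim> \<lambda> a\<^sub>n\<close>. Since \<open>L\<^sub>n\<close> is increasing and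
  \<open>(k + 1)\<^sup>2 / k\<^sup>2 \<rightarrow> 1\<close>, the limit along these indices extends to all \<open>n\<close>.
\<close>

section \<open>Finite random measures and the Bernoulli law\<close>

text \<open>The conditional law is given for one fixed event of \<open>FM\<close> at a time, whereas
  the new features are counted off the random set S_n. A countable base resolves this. Its first k
  members cut the space into finitely many cells, and the cells shrink to points as k grows. They
  serve twice: being a finite sum of distinct unit masses becomes an event of \<open>FM\<close>, and
  the complement of S_n becomes, almost surely, an increasing union of cells chosen by the past. For
  each of the finitely many possible choices the conditional law is applied to a deterministic Borel
  set that misses S_n, where the Bernoulli atoms do not show and only Poisson points are counted;
  monotone convergence then passes to the limit. The levels k^2 suit log n and n^\<beta> alike: a
  variance of order a_n divided by a_n^2 leaves a multiple of 1/a_n <= 1/k^2, and since the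
  increments of a_n are bounded, the first index at level k overshoots k^2 by a bounded amount
  only.\<close>

lemma space_FM: "space (FM :: 'x::topological_space measure measure) = {N. finite_measure N \<and> sets N = sets borel}"
  by (auto simp: FM_def space_Sup_eq_UN)

lemma measurable_emeasure_FM [measurable]:
  "B \<in> sets (borel :: 'x::topological_space measure) \<Longrightarrow> (\<lambda>N. emeasure N B) \<in> borel_measurable FM"
  by (auto intro!: measurable_Sup1 measurable_vimage_algebra1 simp: FM_def)

text \<open>\<open>FM\<close> is the initial sigma-algebra of the evaluations, so measurability of a
  measure-valued map reduces to that of scalar maps.\<close>

lemma measurable_FM_I:
  assumes "\<And>\<omega>. \<omega> \<in> space M \<Longrightarrow> f \<omega> \<in> space (FM :: 'x::topological_space measure measure)"
    and "\<And>B. B \<in> sets (borel :: 'x measure) \<Longrightarrow> (\<lambda>\<omega>. emeasure (f \<omega>) B) \<in> borel_measurable M"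
  shows "f \<in> measurable M (FM :: 'x measure measure)"
  using assms unfolding FM_def
  by (intro measurable_SUP2 measurable_vimage_algebra2)
     (auto simp: FM_def[symmetric] space_FM)

text \<open>Weight 1 gives the point counts of \<open>sum_dirac\<close> and
  \<open>set_dirac\<close>; general weights give the atomic part of the hazard measure. Indexing by
  I rather than by points lets points repeat.\<close>

lemma countably_additive_weighted_points:
  fixes w :: "'i \<Rightarrow> ennreal" and \<xi> :: "'i \<Rightarrow> 'b"
  assumes "finite I"
  shows "countably_additive \<A> (\<lambda>A. \<Sum>i\<in>I. w i * indicator A (\<xi> i))"
proof (rule countably_additiveI)
  fix A :: "nat \<Rightarrow> 'b set" assume A: "disjoint_family A"
  have "(\<Sum>n. \<Sum>i\<in>I. w i * indicator (A n) (\<xi> i)) = (\<Sum>i\<in>I. \<Sum>n. w i * indicator (A n) (\<xi> i))"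
    by (intro suminf_sum) auto
  also have "\<dots> = (\<Sum>i\<in>I. w i * indicator (\<Union>n. A n) (\<xi> i))"
    using A by (simp add: suminf_indicator ennreal_suminf_cmult)
  finally show "(\<Sum>n. \<Sum>i\<in>I. w i * indicator (A n) (\<xi> i)) = (\<Sum>i\<in>I. w i * indicator (\<Union>n. A n) (\<xi> i))" .
qed

text \<open>A \<open>measure_of\<close> whose set function is not countably additive is 0
  everywhere, so each measure built this way needs its additivity checked before its values can be
  used.\<close>

lemma emeasure_measure_of_borel:
  assumes "countably_additive (sets (borel :: 'x::topological_space measure)) \<mu>" "\<mu> {} = 0"
    and "A \<in> sets (borel :: 'x measure)"
  shows "emeasure (measure_of UNIV (sets (borel :: 'x measure)) \<mu>) A = \<mu> A"
  using assms sets.sigma_algebra_axioms[of "borel :: 'x measure"]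
  by (intro emeasure_measure_of_sigma) (auto simp: positive_def)

lemma sets_measure_of_borel [simp]:
  "sets (measure_of UNIV (sets (borel :: 'x::topological_space measure)) \<mu>) = sets borel"
  using sets.sigma_sets_eq[of "borel :: 'x measure"] by (simp add: sets_measure_of_conv)

lemma space_measure_of_borel [simp]:
  "space (measure_of UNIV (sets (borel :: 'x::topological_space measure)) \<mu>) = UNIV"
  by (simp add: space_measure_of_conv)

lemma
  shows sets_sum_dirac [simp]: "sets (sum_dirac k \<xi>) = sets borel"
    and space_sum_dirac [simp]: "space (sum_dirac k \<xi>) = UNIV"
    and sets_set_dirac [simp]: "sets (set_dirac D) = sets borel"
    and space_set_dirac [simp]: "space (set_dirac D) = UNIV"
    and sets_add_meas [simp]: "sets (add_meas \<mu>1 \<mu>2) = sets borel"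
    and space_add_meas [simp]: "space (add_meas \<mu>1 \<mu>2) = UNIV"
  by (simp_all add: sum_dirac_def set_dirac_def add_meas_def)

lemma emeasure_sum_dirac:
  assumes "B \<in> sets (borel :: 'x::topological_space measure)"
  shows "emeasure (sum_dirac k \<xi>) B = (\<Sum>i<k. indicator B (\<xi> i :: 'x))"
proof -
  have eq: "(\<lambda>A. of_nat (card {i. i < k \<and> \<xi> i \<in> A}) :: ennreal) = (\<lambda>A. \<Sum>i<k. 1 * indicator A (\<xi> i))"
  proof
    fix A
    have "(\<Sum>i<k. 1 * indicator A (\<xi> i)) = (\<Sum>i<k. indicator {i. \<xi> i \<in> A} i :: ennreal)"
      by (intro sum.cong) (auto simp: indicator_def)
    also have "\<dots> = of_nat (card ({..<k} \<inter> {i. \<xi> i \<in> A}))"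
      by (simp add: indicator_def sum.If_cases)
    also have "{..<k} \<inter> {i. \<xi> i \<in> A} = {i. i < k \<and> \<xi> i \<in> A}" by auto
    finally show "of_nat (card {i. i < k \<and> \<xi> i \<in> A}) = (\<Sum>i<k. 1 * indicator A (\<xi> i) :: ennreal)" ..
  qed
  show ?thesis unfolding sum_dirac_def eq
    using assms countably_additive_weighted_points[of "{..<k}" "sets borel" "\<lambda>_. 1" \<xi>]
    by (subst emeasure_measure_of_borel) auto
qed

lemma emeasure_set_dirac:
  assumes "B \<in> sets (borel :: 'x::topological_space measure)" "finite D"
  shows "emeasure (set_dirac D) B = (\<Sum>x\<in>D. indicator B (x :: 'x))"
proof -
  have eq: "(\<lambda>A. if finite D then of_nat (card (D \<inter> A)) else 0) = (\<lambda>A. \<Sum>x\<in>D. 1 * indicator A x :: ennreal)"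
    using assms by (simp add: indicator_def sum.If_cases fun_eq_iff)
  show ?thesis unfolding set_dirac_def eq
    using assms countably_additive_weighted_points[of D "sets borel" "\<lambda>_. 1" "\<lambda>x. x"]
    by (subst emeasure_measure_of_borel) auto
qed

lemma emeasure_add_meas:
  assumes "\<mu>1 \<in> space (FM :: 'x::topological_space measure measure)" "\<mu>2 \<in> space (FM :: 'x measure measure)"
    and B: "B \<in> sets (borel :: 'x measure)"
  shows "emeasure (add_meas \<mu>1 \<mu>2) B = emeasure \<mu>1 B + emeasure \<mu>2 B"
proof -
  have s: "sets \<mu>1 = sets borel" "sets \<mu>2 = sets borel" using assms by (auto simp: space_FM)
  show ?thesis unfolding add_meas_def
  proof (rule emeasure_measure_of_borel[OF _ _ B])
    show "countably_additive (sets borel) (\<lambda>A. emeasure \<mu>1 A + emeasure \<mu>2 A)"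
      by (rule countably_additiveI) (simp add: s suminf_emeasure suminf_add[symmetric])
  qed simp
qed

lemma sum_dirac_FM [simp]: "sum_dirac k \<xi> \<in> space FM"
  by (auto simp: space_FM emeasure_sum_dirac intro!: finite_measureI)

lemma set_dirac_FM: "finite D \<Longrightarrow> set_dirac D \<in> space FM"
  by (auto simp: space_FM emeasure_set_dirac intro!: finite_measureI)

lemma add_meas_FM:
  assumes "\<mu>1 \<in> space (FM :: 'x::topological_space measure measure)" "\<mu>2 \<in> space (FM :: 'x measure measure)"
  shows "add_meas \<mu>1 \<mu>2 \<in> space FM"
proof -
  have "emeasure \<mu>1 UNIV \<noteq> \<infinity>" "emeasure \<mu>2 UNIV \<noteq> \<infinity>"
    using assms finite_measure.emeasure_finite by (auto simp: space_FM top.not_eq_extremum)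
  then show ?thesis using assms
    by (auto simp: space_FM[where 'x='x] emeasure_add_meas intro!: finite_measureI)
qed

lemma measurable_sum_dirac:
  assumes "sets q = sets (borel :: 'x::topological_space measure)"
  shows "sum_dirac k \<in> measurable (PiM {..<k} (\<lambda>_. q)) (FM :: 'x measure measure)"
proof (rule measurable_FM_I)
  fix B assume B: "B \<in> sets (borel :: 'x measure)"
  have [measurable]: "B \<in> sets q" using assms B by simp
  show "(\<lambda>\<xi>. emeasure (sum_dirac k \<xi>) B) \<in> borel_measurable (PiM {..<k} (\<lambda>_. q))"
    unfolding emeasure_sum_dirac[OF B] by measurable
qed simp

lemma measurable_set_dirac:
  assumes "finite S"
  shows "(\<lambda>v. set_dirac {x \<in> S. v x}) \<in> measurable (PiM S (\<lambda>x. measure_pmf (p x))) (FM :: 'x::topological_space measure measure)"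
proof (rule measurable_FM_I)
  fix B assume B: "B \<in> sets (borel :: 'x measure)"
  have eq: "emeasure (set_dirac {x \<in> S. v x}) B = (\<Sum>x\<in>S. indicator B x * indicator {b. b} (v x))" for v
  proof -
    have "emeasure (set_dirac {x \<in> S. v x}) B = (\<Sum>x\<in>{x\<in>S. v x}. indicator B x)"
      using assms B by (subst emeasure_set_dirac) auto
    also have "\<dots> = (\<Sum>x\<in>S. indicator B x * indicator {b. b} (v x))"
      using assms by (intro sum.mono_neutral_cong_left) (auto simp: indicator_def)
    finally show ?thesis .
  qed
  show "(\<lambda>v. emeasure (set_dirac {x \<in> S. v x}) B) \<in> borel_measurable (PiM S (\<lambda>x. measure_pmf (p x)))"
    unfolding eq by measurable
qed (use assms in \<open>auto intro: set_dirac_FM\<close>)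

lemma measurable_add_meas:
  "(\<lambda>(\<mu>1, \<mu>2). add_meas \<mu>1 \<mu>2) \<in> measurable (FM \<Otimes>\<^sub>M FM) (FM :: 'x::topological_space measure measure)"
proof (rule measurable_FM_I)
  fix B assume B[measurable]: "B \<in> sets (borel :: 'x measure)"
  have "(\<lambda>\<omega>. emeasure (fst \<omega>) B + emeasure (snd \<omega>) B) \<in> borel_measurable (FM \<Otimes>\<^sub>M FM)"
    by measurable
  then show "(\<lambda>\<omega>. emeasure (case \<omega> of (\<mu>1, \<mu>2) \<Rightarrow> add_meas \<mu>1 \<mu>2) B) \<in> borel_measurable (FM \<Otimes>\<^sub>M FM)"
    by (subst measurable_cong[where g="\<lambda>\<omega>. emeasure (fst \<omega>) B + emeasure (snd \<omega>) B"])
       (auto simp: space_pair_measure emeasure_add_meas)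
qed (auto simp: space_pair_measure add_meas_FM)

text \<open>The form that every hazard measure of the model takes: finitely many atoms at S and t
  times m elsewhere. The weights at the atoms stay open, since moments are computed only off S.
  Positivity of t selects the Poisson branch of \<open>Poi\<close> and makes the normalised diffuse
  part equal to m.\<close>

locale mixed_hazard =
  fixes \<nu> m :: "'x::{metric_space, second_countable_topology} measure" and S :: "'x set" and t :: real
  assumes sets_nu: "sets \<nu> = sets borel"
    and m: "prob_space m" and sets_m: "sets m = sets borel" and diffuse: "\<And>x. emeasure m {x} = 0"
    and atoms_nu: "atoms \<nu> = S" and finite_S: "finite S" and t_pos: "t > 0"
    and nu_off_S: "\<And>A. A \<in> sets borel \<Longrightarrow> emeasure \<nu> (A - S) = ennreal t * emeasure m A"
begin

lemma diffuse_part_eq: "diffuse_part \<nu> = scale_measure (ennreal t) m"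
proof (rule measure_eqI)
  fix A assume "A \<in> sets (diffuse_part \<nu>)"
  then have A: "A \<in> sets borel" by (simp add: diffuse_part_def)
  have "countably_additive (sets borel) (\<lambda>A. emeasure \<nu> (A - atoms \<nu>))"
  proof (rule countably_additiveI)
    fix A :: "nat \<Rightarrow> 'x set" assume A: "range A \<subseteq> sets borel" "disjoint_family A"
    have "(\<Sum>i. emeasure \<nu> (A i - S)) = emeasure \<nu> (\<Union>i. A i - S)"
      using A finite_imp_closed[OF finite_S, THEN borel_closed] by (intro suminf_emeasure)
        (auto simp: sets_nu disjoint_family_on_def)
    also have "(\<Union>i. A i - S) = (\<Union>i. A i) - S" by auto
    finally show "(\<Sum>i. emeasure \<nu> (A i - atoms \<nu>)) = emeasure \<nu> ((\<Union>i. A i) - atoms \<nu>)"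
      by (simp add: atoms_nu)
  qed
  then show "emeasure (diffuse_part \<nu>) A = emeasure (scale_measure (ennreal t) m) A"
    unfolding diffuse_part_def using A
    by (subst emeasure_measure_of_borel) (auto simp: atoms_nu nu_off_S)
qed (simp add: diffuse_part_def sets_m)

lemma measure_diffuse_part: "measure (diffuse_part \<nu>) UNIV = t"
proof -
  interpret m: prob_space m by (rule m)
  have "space m = UNIV" using sets_eq_imp_space_eq[OF sets_m] by simp
  then have "measure m UNIV = 1" using m.prob_space by simp
  then show ?thesis using t_pos
    by (simp add: diffuse_part_eq measure_scale_measure)
qed

lemma poisson_rm_law_eq:
  "poisson_rm_law (diffuse_part \<nu>) =
    measure_pmf (poisson_pmf t) \<bind> (\<lambda>k. distr (PiM {..<k} (\<lambda>_. m)) FM (sum_dirac k))"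
proof -
  have "measure_of UNIV (sets borel) (\<lambda>A. emeasure (diffuse_part \<nu>) A / ennreal t) = m"
  proof (rule measure_eqI)
    fix A assume "A \<in> sets (measure_of UNIV (sets borel) (\<lambda>A. emeasure (diffuse_part \<nu>) A / ennreal t))"
    then have A: "A \<in> sets borel" by simp
    have eq: "(\<lambda>A. emeasure (diffuse_part \<nu>) A / ennreal t) = emeasure m"
      using t_pos by (simp add: diffuse_part_eq ennreal_mult_divide_eq fun_eq_iff mult.commute[of "ennreal t"])
    show "emeasure (measure_of UNIV (sets borel) (\<lambda>A. emeasure (diffuse_part \<nu>) A / ennreal t)) A = emeasure m A"
      unfolding eq using A emeasure_countably_additive[of m]
      by (subst emeasure_measure_of_borel) (auto simp: sets_m)
  qed (simp add: sets_m)
  then show ?thesis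
    unfolding poisson_rm_law_def measure_diffuse_part Let_def using t_pos by (simp add: Poi_def)
qed

lemma prob_space_points: "prob_space (distr (PiM {..<k} (\<lambda>_. m)) FM (sum_dirac k))"
  by (intro prob_space.prob_space_distr measurable_sum_dirac sets_m prob_space_PiM m)

lemma points_kernel:
  "(\<lambda>k. distr (PiM {..<k} (\<lambda>_. m)) FM (sum_dirac k)) \<in> measurable (measure_pmf (poisson_pmf t)) (subprob_algebra FM)"
  by (auto simp: space_subprob_algebra intro: prob_space_imp_subprob_space prob_space_points)

lemma prob_space_poisson_rm_law: "prob_space (poisson_rm_law (diffuse_part \<nu>))"
  unfolding poisson_rm_law_eq
  by (intro prob_space.prob_space_bind[OF _ _ points_kernel] measure_pmf.prob_space_axioms)
     (simp add: prob_space_points)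

lemma prob_space_atom_rm_law: "prob_space (atom_rm_law \<nu>)"
  unfolding atom_rm_law_def atoms_nu
  by (intro prob_space.prob_space_distr measurable_set_dirac finite_S prob_space_PiM measure_pmf.prob_space_axioms)

lemma sets_poisson_rm_law: "sets (poisson_rm_law (diffuse_part \<nu>)) = sets FM"
  unfolding poisson_rm_law_eq by (rule sets_bind[OF sets_kernel[OF points_kernel]]) auto

lemma sets_atom_rm_law: "sets (atom_rm_law \<nu>) = sets FM"
  by (simp add: atom_rm_law_def)

lemma measurable_add_meas': 
  "(\<lambda>(\<mu>1, \<mu>2). add_meas \<mu>1 \<mu>2) \<in> measurable (poisson_rm_law (diffuse_part \<nu>) \<Otimes>\<^sub>M atom_rm_law \<nu>) FM"
  using measurable_add_meas
  by (simp add: sets_poisson_rm_law sets_atom_rm_law cong: measurable_cong_sets sets_pair_measure_cong)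

lemma prob_space_BeP: "prob_space (BeP \<nu>)"
proof -
  interpret A: prob_space "poisson_rm_law (diffuse_part \<nu>)" by (rule prob_space_poisson_rm_law)
  interpret B: prob_space "atom_rm_law \<nu>" by (rule prob_space_atom_rm_law)
  interpret AB: pair_prob_space "poisson_rm_law (diffuse_part \<nu>)" "atom_rm_law \<nu>" ..
  show ?thesis unfolding BeP_def
    by (intro AB.prob_space_distr measurable_add_meas')
qed

text \<open>Unfolds the law into a sampling recipe: a Poisson number k, then k independent points
  with law m, and an independent coin for each atom in S. Moments and simplicity are both computed
  on such samples.\<close>

lemma nn_integral_BeP:
  assumes [measurable]: "f \<in> borel_measurable FM"
  shows "(\<integral>\<^sup>+N. f N \<partial>BeP \<nu>) =
    (\<integral>\<^sup>+k. \<integral>\<^sup>+\<xi>. \<integral>\<^sup>+v. f (add_meas (sum_dirac k \<xi>) (set_dirac {x \<in> S. v x}))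
       \<partial>PiM S (\<lambda>x. measure_pmf (bernoulli_pmf (measure \<nu> {x}))) \<partial>PiM {..<k} (\<lambda>_. m) \<partial>poisson_pmf t)"
proof -
  interpret B: prob_space "atom_rm_law \<nu>" by (rule prob_space_atom_rm_law)
  have F[measurable]: "(\<lambda>(\<mu>1, \<mu>2). f (add_meas \<mu>1 \<mu>2)) \<in> borel_measurable (FM \<Otimes>\<^sub>M FM)"
    using measurable_compose[OF measurable_add_meas assms] by (simp add: case_prod_beta')
  have G: "(\<lambda>(\<mu>1, \<mu>2). f (add_meas \<mu>1 \<mu>2)) \<in> borel_measurable (poisson_rm_law (diffuse_part \<nu>) \<Otimes>\<^sub>M atom_rm_law \<nu>)"
    using F by (simp add: sets_poisson_rm_law sets_atom_rm_law cong: measurable_cong_sets sets_pair_measure_cong)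
  have H: "(\<lambda>(\<mu>1, \<mu>2). f (add_meas \<mu>1 \<mu>2)) \<in> borel_measurable (FM \<Otimes>\<^sub>M atom_rm_law \<nu>)"
    using F by (simp add: sets_atom_rm_law cong: measurable_cong_sets sets_pair_measure_cong)
  have I: "(\<lambda>\<mu>1. \<integral>\<^sup>+\<mu>2. f (add_meas \<mu>1 \<mu>2) \<partial>atom_rm_law \<nu>) \<in> borel_measurable FM"
    using B.borel_measurable_nn_integral_fst[OF H] by simp
  have inner: "(\<integral>\<^sup>+\<mu>2. f (add_meas \<mu>1 \<mu>2) \<partial>atom_rm_law \<nu>) =
     (\<integral>\<^sup>+v. f (add_meas \<mu>1 (set_dirac {x \<in> S. v x})) \<partial>PiM S (\<lambda>x. measure_pmf (bernoulli_pmf (measure \<nu> {x}))))"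
    if "\<mu>1 \<in> space FM" for \<mu>1
    unfolding atom_rm_law_def atoms_nu
    by (intro nn_integral_distr measurable_set_dirac finite_S)
       (use measurable_Pair2[OF F that] in simp)
  have "(\<integral>\<^sup>+N. f N \<partial>BeP \<nu>) = (\<integral>\<^sup>+x. f (case x of (\<mu>1, \<mu>2) \<Rightarrow> add_meas \<mu>1 \<mu>2) \<partial>(poisson_rm_law (diffuse_part \<nu>) \<Otimes>\<^sub>M atom_rm_law \<nu>))"
    unfolding BeP_def by (rule nn_integral_distr[OF measurable_add_meas']) simp
  also have "\<dots> = (\<integral>\<^sup>+\<mu>1. \<integral>\<^sup>+\<mu>2. f (add_meas \<mu>1 \<mu>2) \<partial>atom_rm_law \<nu> \<partial>poisson_rm_law (diffuse_part \<nu>))"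
    using B.nn_integral_fst[OF G] by (simp add: case_prod_beta')
  also have "\<dots> = (\<integral>\<^sup>+k. \<integral>\<^sup>+\<mu>1. \<integral>\<^sup>+\<mu>2. f (add_meas \<mu>1 \<mu>2) \<partial>atom_rm_law \<nu> \<partial>distr (PiM {..<k} (\<lambda>_. m)) FM (sum_dirac k) \<partial>poisson_pmf t)"
    unfolding poisson_rm_law_eq by (rule nn_integral_bind[OF I points_kernel])
  also have "\<dots> = (\<integral>\<^sup>+k. \<integral>\<^sup>+\<xi>. \<integral>\<^sup>+\<mu>2. f (add_meas (sum_dirac k \<xi>) \<mu>2) \<partial>atom_rm_law \<nu> \<partial>PiM {..<k} (\<lambda>_. m) \<partial>poisson_pmf t)"
    by (intro nn_integral_cong nn_integral_distr measurable_sum_dirac sets_m) (use I in simp)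
  also have "\<dots> = (\<integral>\<^sup>+k. \<integral>\<^sup>+\<xi>. \<integral>\<^sup>+v. f (add_meas (sum_dirac k \<xi>) (set_dirac {x \<in> S. v x}))
       \<partial>PiM S (\<lambda>x. measure_pmf (bernoulli_pmf (measure \<nu> {x}))) \<partial>PiM {..<k} (\<lambda>_. m) \<partial>poisson_pmf t)"
    by (intro nn_integral_cong inner) simp
  finally show ?thesis .
qed

end

section \<open>Moments and simplicity of Bernoulli measures\<close>

text \<open>The falling factorials cancel against \<open>fact k\<close>, so each moment is the
  preceding series shifted by one index and multiplied by t. The second moment is factorial because
  a squared count produces pairs of distinct points.\<close>

lemma poisson_factorial_moments:
  assumes "t > 0"
  shows "(\<integral>\<^sup>+k. of_nat k \<partial>poisson_pmf t) = ennreal t"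
    and "(\<integral>\<^sup>+k. of_nat (k * (k - 1)) \<partial>poisson_pmf t) = ennreal (t\<^sup>2)"
proof -
  have e: "(\<lambda>j. t ^ j / fact j * exp (- t)) sums 1"
    using sums_mult2[OF exp_converges[of t], of "exp (- t)"] by (simp add: exp_minus field_simps)
  have 1: "(\<lambda>k. real k * (t ^ k / fact k * exp (- t))) sums t"
  proof -
    have "(\<lambda>j. real (Suc j) * (t ^ Suc j / fact (Suc j) * exp (- t))) = (\<lambda>j. t * (t ^ j / fact j * exp (- t)))"
      by (rule ext) (simp add: field_simps del: of_nat_Suc)
    then have "(\<lambda>j. real (Suc j) * (t ^ Suc j / fact (Suc j) * exp (- t))) sums t"
      using sums_mult[OF e, of t] by simp
    then show ?thesis by (subst (asm) sums_Suc_iff) simp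
  qed
  have 2: "(\<lambda>k. real (k * (k - 1)) * (t ^ k / fact k * exp (- t))) sums t\<^sup>2"
  proof -
    have "(\<lambda>j. real (Suc j * j) * (t ^ Suc j / fact (Suc j) * exp (- t))) = (\<lambda>j. t * (real j * (t ^ j / fact j * exp (- t))))"
      by (rule ext, unfold of_nat_mult fact_Suc) (simp add: field_simps del: of_nat_Suc)
    then have "(\<lambda>j. real (Suc j * (Suc j - 1)) * (t ^ Suc j / fact (Suc j) * exp (- t))) sums t\<^sup>2"
      using sums_mult[OF 1, of t] by (simp add: power2_eq_square)
    then show ?thesis by (subst (asm) sums_Suc_iff) simp
  qed
  have "(\<integral>\<^sup>+k. of_nat (f k) \<partial>poisson_pmf t) = (\<Sum>k. ennreal (real (f k) * (t ^ k / fact k * exp (- t))))" for f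
  proof -
    have "ennreal (pmf (poisson_pmf t) k) * of_nat (f k) = ennreal (real (f k) * (t ^ k / fact k * exp (- t)))" for k
      using assms by (subst ennreal_mult) (simp_all add: ennreal_of_nat_eq_real_of_nat mult.commute)
    then show ?thesis by (simp add: nn_integral_measure_pmf nn_integral_count_space_nat del: pmf_poisson)
  qed
  note eq = this
  show "(\<integral>\<^sup>+k. of_nat k \<partial>poisson_pmf t) = ennreal t"
    by (rule trans[OF eq[of "\<lambda>k. k"] suminf_ennreal_eq[OF _ 1]]) (use assms in simp)
  show "(\<integral>\<^sup>+k. of_nat (k * (k - 1)) \<partial>poisson_pmf t) = ennreal (t\<^sup>2)"
    by (rule trans[OF eq[of "\<lambda>k. k * (k - 1)"] suminf_ennreal_eq[OF _ 2]]) (use assms in simp)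
qed

text \<open>In the squared count each of the k diagonal pairs gives the mass of V, since an
  indicator is its own square, and each of the k (k - 1) ordered pairs of distinct indices gives the
  square of that mass by independence.\<close>

lemma iid_count_moments:
  assumes m: "prob_space m" and V[measurable]: "V \<in> sets m"
  shows "(\<integral>\<^sup>+\<xi>. (\<Sum>i<k. indicator V (\<xi> i)) \<partial>PiM {..<k} (\<lambda>_. m)) = of_nat k * emeasure m V"
    and "(\<integral>\<^sup>+\<xi>. (\<Sum>i<k. indicator V (\<xi> i))\<^sup>2 \<partial>PiM {..<k} (\<lambda>_. m))
      = of_nat k * emeasure m V + of_nat (k * (k - 1)) * (emeasure m V)\<^sup>2"
proof -
  interpret m: prob_space m by (rule m)
  interpret P: product_prob_space "\<lambda>_::nat. m" by unfold_locales
  have one: "(\<integral>\<^sup>+\<xi>. indicator V (\<xi> i) \<partial>PiM {..<k} (\<lambda>_. m)) = emeasure m V" if "i < k" for i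
  proof -
    have "(\<integral>\<^sup>+\<xi>. indicator V (\<xi> i) \<partial>PiM {..<k} (\<lambda>_. m)) = (\<integral>\<^sup>+x. indicator V x \<partial>distr (PiM {..<k} (\<lambda>_. m)) m (\<lambda>\<xi>. \<xi> i))"
      using that by (subst nn_integral_distr) auto
    also have "distr (PiM {..<k} (\<lambda>_. m)) m (\<lambda>\<xi>. \<xi> i) = m"
      using that by (intro distr_PiM_component) (auto intro: m)
    finally show ?thesis by simp
  qed
  have two: "(\<integral>\<^sup>+\<xi>. indicator V (\<xi> i) * indicator V (\<xi> j) \<partial>PiM {..<k} (\<lambda>_. m)) = (emeasure m V)\<^sup>2"
    if ij: "i < k" "j < k" "i \<noteq> j" for i j
  proof -
    \<comment> \<open>The product formula takes one factor per coordinate; the constant factor 1 off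
      i and j integrates to 1 because m is a probability.\<close>
    define f :: "nat \<Rightarrow> 'a \<Rightarrow> ennreal" where "f l x = (if l \<in> {i, j} then indicator V x else 1)" for l x
    have [measurable]: "f l \<in> borel_measurable m" for l unfolding f_def by measurable
    have sub: "{..<k} \<inter> {i,j} = {i,j}" using ij by auto
    have "(\<Prod>l<k. f l (\<xi> l)) = indicator V (\<xi> i) * indicator V (\<xi> j)" for \<xi>
      unfolding f_def prod.If_cases[OF finite_lessThan] Collect_mem_eq sub using ij by simp
    moreover have "(\<Prod>l<k. \<integral>\<^sup>+x. f l x \<partial>m) = (emeasure m V)\<^sup>2"
    proof -
      have "(\<Prod>l<k. \<integral>\<^sup>+x. f l x \<partial>m) = (\<Prod>l<k. if l \<in> {i, j} then emeasure m V else 1)"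
        by (intro prod.cong) (auto simp: f_def m.emeasure_space_1)
      also have "\<dots> = (emeasure m V)\<^sup>2"
        unfolding prod.If_cases[OF finite_lessThan] Collect_mem_eq sub using ij by (simp add: power2_eq_square)
      finally show ?thesis .
    qed
    ultimately show ?thesis
      using P.product_nn_integral_prod[of "{..<k}" f] by simp
  qed
  show "(\<integral>\<^sup>+\<xi>. (\<Sum>i<k. indicator V (\<xi> i)) \<partial>PiM {..<k} (\<lambda>_. m)) = of_nat k * emeasure m V"
    by (subst nn_integral_sum) (auto simp: one)
  have "(\<integral>\<^sup>+\<xi>. (\<Sum>i<k. indicator V (\<xi> i))\<^sup>2 \<partial>PiM {..<k} (\<lambda>_. m))
     = (\<integral>\<^sup>+\<xi>. (\<Sum>i<k. \<Sum>j<k. indicator V (\<xi> i) * indicator V (\<xi> j)) \<partial>PiM {..<k} (\<lambda>_. m))"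
    by (simp add: power2_eq_square sum_product)
  also have "\<dots> = (\<Sum>i<k. \<Sum>j<k. \<integral>\<^sup>+\<xi>. indicator V (\<xi> i) * indicator V (\<xi> j) \<partial>PiM {..<k} (\<lambda>_. m))"
    by (subst nn_integral_sum; (intro sum.cong nn_integral_sum)?) auto
  also have "\<dots> = (\<Sum>i<k. emeasure m V + of_nat (k - 1) * (emeasure m V)\<^sup>2)"
  proof (intro sum.cong refl)
    fix i assume i: "i \<in> {..<k}"
    have "(\<Sum>j<k. \<integral>\<^sup>+\<xi>. indicator V (\<xi> i) * indicator V (\<xi> j) \<partial>PiM {..<k} (\<lambda>_. m))
      = (\<integral>\<^sup>+\<xi>. indicator V (\<xi> i) * indicator V (\<xi> i) \<partial>PiM {..<k} (\<lambda>_. m))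
      + (\<Sum>j\<in>{..<k} - {i}. \<integral>\<^sup>+\<xi>. indicator V (\<xi> i) * indicator V (\<xi> j) \<partial>PiM {..<k} (\<lambda>_. m))"
      using i by (intro sum.remove) auto
    also have "(\<integral>\<^sup>+\<xi>. indicator V (\<xi> i) * indicator V (\<xi> i) \<partial>PiM {..<k} (\<lambda>_. m)) = emeasure m V"
      using one[of i] i by (simp flip: indicator_inter_arith)
    also have "(\<Sum>j\<in>{..<k} - {i}. \<integral>\<^sup>+\<xi>. indicator V (\<xi> i) * indicator V (\<xi> j) \<partial>PiM {..<k} (\<lambda>_. m))
      = (\<Sum>j\<in>{..<k} - {i}. (emeasure m V)\<^sup>2)"
      using i by (intro sum.cong two) auto
    also have "\<dots> = of_nat (k - 1) * (emeasure m V)\<^sup>2" using i by simp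
    finally show "(\<Sum>j<k. \<integral>\<^sup>+\<xi>. indicator V (\<xi> i) * indicator V (\<xi> j) \<partial>PiM {..<k} (\<lambda>_. m))
      = emeasure m V + of_nat (k - 1) * (emeasure m V)\<^sup>2" .
  qed
  also have "\<dots> = of_nat k * emeasure m V + of_nat (k * (k - 1)) * (emeasure m V)\<^sup>2"
    by (simp add: distrib_left mult.assoc)
  finally show "(\<integral>\<^sup>+\<xi>. (\<Sum>i<k. indicator V (\<xi> i))\<^sup>2 \<partial>PiM {..<k} (\<lambda>_. m))
      = of_nat k * emeasure m V + of_nat (k * (k - 1)) * (emeasure m V)\<^sup>2" .
qed

text \<open>Given the other coordinates, a coincidence of \<open>\<xi> i\<close> with
  \<open>\<xi> j\<close> means that one point of law m hits a fixed point, which has probability 0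
  as m is diffuse.\<close>

lemma AE_iid_distinct_avoiding:
  fixes m :: "'x::{metric_space, second_countable_topology} measure"
  assumes m: "prob_space m" and s: "sets m = sets borel" and diffuse: "\<And>x. emeasure m {x} = 0"
    and S: "finite S"
  shows "AE \<xi> in PiM {..<k::nat} (\<lambda>_. m). inj_on \<xi> {..<k} \<and> (\<forall>i<k. \<xi> i \<notin> S)"
proof -
  interpret m: prob_space m by (rule m)
  interpret P: product_prob_space "\<lambda>_::nat. m" by unfold_locales
  have c: "(\<lambda>\<xi>. \<xi> i) \<in> borel_measurable (PiM {..<k} (\<lambda>_. m))" if "i < k" for i
    using measurable_component_singleton[of i "{..<k}" "\<lambda>_. m"] that
    by (simp add: measurable_cong_sets[OF refl s])
  have neq: "AE \<xi> in PiM {..<k} (\<lambda>_. m). \<xi> i \<noteq> \<xi> j" if "i < k" "j < k" "i \<noteq> j" for i j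
  proof -
    \<comment> \<open>The diagonal is an event because it is the zero set of the distance, which is
      jointly Borel thanks to the countable base.\<close>
    have meas: "{\<xi> \<in> space (PiM {..<k} (\<lambda>_. m)). \<xi> i = \<xi> j} \<in> sets (PiM {..<k} (\<lambda>_. m))"
      using measurable_sets[OF borel_measurable_dist[OF c[OF that(1)] c[OF that(2)]], of "{0}"]
      by (simp add: vimage_def Int_def conj_commute)
    define I where "I = {..<k} - {i}"
    have I: "insert i I = {..<k}" "finite I" "i \<notin> I" "j \<in> I" using that by (auto simp: I_def)
    have "emeasure (PiM {..<k} (\<lambda>_. m)) {\<xi> \<in> space (PiM {..<k} (\<lambda>_. m)). \<xi> i = \<xi> j}
      = (\<integral>\<^sup>+\<xi>. indicator {\<xi> \<in> space (PiM {..<k} (\<lambda>_. m)). \<xi> i = \<xi> j} \<xi> \<partial>PiM (insert i I) (\<lambda>_. m))"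
      using meas by (simp add: I)
    also have "\<dots> = (\<integral>\<^sup>+\<xi>. \<integral>\<^sup>+y. indicator {\<xi> \<in> space (PiM {..<k} (\<lambda>_. m)). \<xi> i = \<xi> j} (\<xi>(i := y)) \<partial>m \<partial>PiM I (\<lambda>_. m))"
      by (rule P.product_nn_integral_insert) (use I meas in auto)
    also have "\<dots> \<le> (\<integral>\<^sup>+\<xi>. \<integral>\<^sup>+y. indicator {\<xi> j} y \<partial>m \<partial>PiM I (\<lambda>_. m))"
      using that by (intro nn_integral_mono) (auto simp: indicator_def)
    also have "\<dots> = 0" using diffuse by (simp add: s)
    finally show ?thesis using meas by (intro AE_I[where N="{\<xi> \<in> space (PiM {..<k} (\<lambda>_. m)). \<xi> i = \<xi> j}"]) auto
  qed
  have avoid: "AE \<xi> in PiM {..<k} (\<lambda>_. m). \<xi> i \<notin> S" if "i < k" for i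
  proof -
    have "AE x in m. x \<notin> S"
    proof (rule AE_not_in)
      have "(\<Union>x\<in>S. {x}) \<in> null_sets m"
        using S diffuse by (intro null_sets.finite_UN) (auto intro!: null_setsI simp: s)
      then show "S \<in> null_sets m" by simp
    qed
    moreover have "distr (PiM {..<k} (\<lambda>_. m)) m (\<lambda>\<xi>. \<xi> i) = m"
      using that by (intro distr_PiM_component) (auto intro: m)
    ultimately have "AE x in distr (PiM {..<k} (\<lambda>_. m)) m (\<lambda>\<xi>. \<xi> i). x \<notin> S" by metis
    moreover have "S \<in> sets m" using finite_imp_closed[OF S] by (simp add: s)
    ultimately show ?thesis using that by (subst (asm) AE_distr_iff) auto
  qed
  have "AE \<xi> in PiM {..<k} (\<lambda>_. m). \<forall>i\<in>{..<k}. \<forall>j\<in>{..<k}. i \<noteq> j \<longrightarrow> \<xi> i \<noteq> \<xi> j"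
    by (intro AE_finite_allI) (auto intro: neq)
  moreover have "AE \<xi> in PiM {..<k} (\<lambda>_. m). \<forall>i\<in>{..<k}. \<xi> i \<notin> S"
    by (intro AE_finite_allI) (auto intro: avoid)
  ultimately show ?thesis by eventually_elim (auto simp: inj_on_def)
qed

section \<open>Finite Borel partitions generated by a countable base\<close>

definition base_seq :: "nat \<Rightarrow> 'x::second_countable_topology set" where
  "base_seq = from_nat_into (SOME B. countable B \<and> topological_basis B)"

text \<open>These are the atoms of the algebra generated by the first k base sets: a finite Borel
  partition that gets finer with k.\<close>

definition cell :: "nat \<Rightarrow> 'x::second_countable_topology \<Rightarrow> 'x set" where
  "cell k x = {y. \<forall>i<k. y \<in> base_seq i \<longleftrightarrow> x \<in> base_seq i}"

lemma base_seq_basis: "topological_basis (range (base_seq :: nat \<Rightarrow> 'x::second_countable_topology set))"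
proof -
  define B :: "'x set set" where "B = (SOME B. countable B \<and> topological_basis B)"
  have B: "countable B" "topological_basis B"
    using someI_ex[OF ex_countable_basis] by (auto simp: B_def)
  have "B \<noteq> {}"
    using topological_basisE[OF B(2) open_UNIV UNIV_I] by (metis empty_iff)
  then have "range base_seq = B"
    using B(1) by (simp add: base_seq_def B_def[symmetric] range_from_nat_into)
  then show ?thesis using B by simp
qed

lemma open_base_seq: "open (base_seq i)"
  using base_seq_basis by (rule topological_basis_open) simp

lemma cell_borel [measurable]: "cell k x \<in> sets borel"
proof -
  have "cell k x = (\<Inter>i. if i < k then if x \<in> base_seq i then base_seq i else - base_seq i else UNIV)"
    by (auto simp: cell_def split: if_splits)
  also have "\<dots> \<in> sets borel"
    by (intro sets.countable_INT) (auto simp: open_base_seq borel_open)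
  finally show ?thesis .
qed

lemma cell_self [simp]: "x \<in> cell k x"
  by (simp add: cell_def)

lemma cell_antimono: "k \<le> l \<Longrightarrow> cell l x \<subseteq> cell k x"
  by (auto simp: cell_def)

lemma cell_eq: "y \<in> cell k x \<Longrightarrow> cell k y = cell k x"
  by (auto simp: cell_def)

lemma finite_cells: "finite (range (cell k))"
proof -
  have "cell k x = (\<lambda>J. {y. \<forall>i<k. y \<in> base_seq i \<longleftrightarrow> i \<in> J}) {i. i < k \<and> x \<in> base_seq i}" for x :: 'a
    by (auto simp: cell_def)
  then have "range (cell k :: 'a \<Rightarrow> _) \<subseteq> (\<lambda>J. {y. \<forall>i<k. y \<in> base_seq i \<longleftrightarrow> i \<in> J}) ` Pow {..<k}"
    by blast
  then show ?thesis by (rule finite_subset) simp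
qed

lemma eventually_cell_separates:
  fixes x y :: "'x::{t2_space, second_countable_topology}"
  assumes "x \<noteq> y"
  shows "\<forall>\<^sub>F k in sequentially. y \<notin> cell k x"
proof -
  obtain U where U: "open U" "x \<in> U" "y \<notin> U"
    using assms t1_space by metis
  obtain i where "x \<in> base_seq i" "base_seq i \<subseteq> U"
    using topological_basisE[OF base_seq_basis U(1,2)] by (metis imageE)
  \<comment> \<open>A base set with index i first influences the cells at level i + 1.\<close>
  then have "y \<notin> cell k x" if "Suc i \<le> k" for k
    using U that by (auto simp: cell_def intro!: exI[of _ i])
  then show ?thesis unfolding eventually_sequentially by blast
qed

lemma eventually_cell_Int_finite:
  fixes x :: "'x::{t2_space, second_countable_topology}"
  assumes "finite E"
  shows "\<forall>\<^sub>F k in sequentially. E \<inter> cell k x \<subseteq> {x}"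
proof -
  have "\<forall>\<^sub>F k in sequentially. \<forall>y\<in>E - {x}. y \<notin> cell k x"
    using assms by (intro eventually_ball_finite ballI eventually_cell_separates) auto
  then show ?thesis by eventually_elim auto
qed

lemma INT_cell: "(\<Inter>k. cell k x) = {x :: 'x::{t2_space, second_countable_topology}}"
proof (intro equalityI subsetI)
  fix y assume y: "y \<in> (\<Inter>k. cell k x)"
  show "y \<in> {x}"
  proof (rule ccontr)
    assume "y \<notin> {x}"
    then have "\<forall>\<^sub>F k in sequentially. y \<notin> cell k x"
      by (intro eventually_cell_separates) auto
    with y show False by (auto simp: eventually_sequentially)
  qed
qed auto

text \<open>An FM-measurable way to say that a finite measure is a finite sum of distinct unit point masses.\<close>
definition simple_measure :: "'x::second_countable_topology measure \<Rightarrow> bool" where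
  "simple_measure N \<longleftrightarrow> (\<exists>k. \<forall>l\<ge>k. \<forall>C\<in>range (cell l). emeasure N C \<in> {0, 1})"

lemma simple_measure_measurable [measurable]: "Measurable.pred FM simple_measure"
proof -
  have [measurable]: "C \<in> range (cell l) \<Longrightarrow> C \<in> sets borel" for C l by auto
  have [simp]: "finite (range (cell l))" for l by (rule finite_cells)
  show ?thesis unfolding simple_measure_def[abs_def]
    by measurable
qed

text \<open>From some level on no cell contains two points of E, so each cell has mass 0 or
  1.\<close>

lemma simple_measureI:
  fixes E :: "'x::{t2_space, second_countable_topology} set"
  assumes E: "finite E" and N: "\<And>B. B \<in> sets borel \<Longrightarrow> emeasure N B = (\<Sum>x\<in>E. indicator B x)"
  shows "simple_measure N"
proof -
  have "\<forall>\<^sub>F k in sequentially. \<forall>x\<in>E. E \<inter> cell k x \<subseteq> {x}"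
    using E by (intro eventually_ball_finite ballI eventually_cell_Int_finite) auto
  then obtain k where k: "\<And>l x. l \<ge> k \<Longrightarrow> x \<in> E \<Longrightarrow> E \<inter> cell l x \<subseteq> {x}"
    unfolding eventually_sequentially by blast
  have "emeasure N (cell l y) \<in> {0, 1}" if l: "l \<ge> k" for l y
  proof (cases "E \<inter> cell l y = {}")
    case True
    then have "(\<Sum>x\<in>E. indicator (cell l y) x :: ennreal) = 0" by (intro sum.neutral) (auto simp: indicator_def)
    then show ?thesis by (simp add: N)
  next
    case False
    then obtain x where x: "x \<in> E" "x \<in> cell l y" by auto
    then have eq: "E \<inter> cell l y = {x}" using k[OF l x(1)] cell_eq[OF x(2)] by auto
    have "(\<Sum>x\<in>E. indicator (cell l y) x) = (\<Sum>x\<in>E \<inter> cell l y. 1 :: ennreal)"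
      using E by (simp add: indicator_def sum.If_cases)
    then show ?thesis unfolding eq by (simp add: N)
  qed
  then show ?thesis unfolding simple_measure_def by blast
qed

text \<open>Each such point takes mass 1 out of a finite total. Since this covers all finite
  measures, the feature sets are finite at every \<omega>, which gives the sums in
  \<open>hazard\<close> their meaning.\<close>

lemma finite_unit_points:
  assumes "N \<in> space (FM :: 'x::t2_space measure measure)"
  shows "finite {x. emeasure N {x} = 1}"
proof -
  interpret finite_measure N using assms by (simp add: space_FM)
  have s: "sets N = sets borel" using assms by (simp add: space_FM)
  show ?thesis
  proof (rule conjunct1[OF finite_if_finite_subsets_card_bdd])
    fix F assume F: "F \<subseteq> {x. emeasure N {x} = 1}" "finite F"
    have "measure N F = (\<Sum>x\<in>F. measure N {x})"
      using F by (intro finite_measure_eq_sum_singleton) (auto simp: s)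
    also have "\<dots> = card F" using F by (simp add: measure_def subset_eq)
    finally have "real (card F) \<le> measure N (space N)" using bounded_measure[of F] by simp
    then show "card F \<le> nat \<lfloor>measure N (space N)\<rfloor>" by (simp add: le_nat_floor)
  qed
qed

text \<open>If no cell around x is null, then from level k on all of them have mass 1, and
  continuity from above along their intersection gives x unit mass. Hence all other points lie in
  null cells. There are only countably many cells, so N is carried by its finitely many unit
  points.\<close>

lemma simple_measure_count:
  fixes N :: "'x::{t2_space, second_countable_topology} measure"
  assumes N: "N \<in> space FM" and simple: "simple_measure N" and B: "B \<in> sets borel"
  shows "emeasure N B = of_nat (card (B \<inter> {x. emeasure N {x} = 1}))"
proof -
  interpret finite_measure N using N by (simp add: space_FM)
  have s: "sets N = sets borel" using N by (simp add: space_FM)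
  define D where "D = {x. emeasure N {x} = 1}"
  have D: "finite D" using finite_unit_points[OF N] by (simp add: D_def)
  obtain k where k: "\<And>l x. l \<ge> k \<Longrightarrow> emeasure N (cell l x) \<in> {0, 1}"
    using simple by (auto simp: simple_measure_def)
  have "(\<Union>l. \<Union>C\<in>{C \<in> range (cell l). emeasure N C = 0}. C) \<in> null_sets N"
    by (intro null_sets_UN null_sets_UN' countable_subset[OF _ countable_finite[OF finite_cells]])
       (auto intro!: null_setsI simp: s)
  moreover have "- D \<subseteq> (\<Union>l. \<Union>C\<in>{C \<in> range (cell l). emeasure N C = 0}. C)"
  proof
    fix x assume x: "x \<in> - D"
    have "\<exists>l. emeasure N (cell l x) = 0"
    proof (rule ccontr)
      assume "\<not> ?thesis"
      then have one: "emeasure N (cell (l + k) x) = 1" for l using k[of "l + k" x] by auto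
      have "emeasure N (\<Inter>l. cell (l + k) x) = (INF l. emeasure N (cell (l + k) x))"
        by (intro INF_emeasure_decseq[symmetric]) (auto simp: s decseq_def cell_antimono)
      also have "(\<Inter>l. cell (l + k) x) = (\<Inter>l. cell l x)"
        using cell_antimono[of l "l + k" x for l] by (auto simp: subset_iff)
      finally show False using x one by (simp add: INT_cell D_def)
    qed
    then show "x \<in> (\<Union>l. \<Union>C\<in>{C \<in> range (cell l). emeasure N C = 0}. C)"
      by (auto intro: cell_self)
  qed
  moreover have "D \<in> sets N" using finite_imp_closed[OF D] by (simp add: s)
  ultimately have null: "emeasure N (- D) = 0"
    by (meson emeasure_eq_0 null_setsD1 null_setsD2)
  have "emeasure N B = emeasure N ((B \<inter> D) \<union> (B - D))" by (simp add: Int_Diff_Un)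
  also have "\<dots> = emeasure N (B \<inter> D)"
    using B \<open>D \<in> sets N\<close> by (intro emeasure_Un_null_set null_setsI emeasure_eq_0[OF _ null]) (auto simp: s)
  also have "\<dots> = (\<Sum>x\<in>B \<inter> D. emeasure N {x})"
    using D by (intro emeasure_eq_sum_singleton) (auto simp: s)
  also have "\<dots> = of_nat (card (B \<inter> D))" by (simp add: D_def)
  finally show ?thesis by (simp add: D_def)
qed

context mixed_hazard
begin

lemma emeasure_BeP_sample:
  assumes "B \<in> sets borel"
  shows "emeasure (add_meas (sum_dirac k \<xi>) (set_dirac {x \<in> S. v x})) B =
    (\<Sum>i<k. indicator B (\<xi> i)) + (\<Sum>x\<in>{x \<in> S. v x}. indicator B x)"
  using assms finite_S by (simp add: emeasure_add_meas set_dirac_FM emeasure_sum_dirac emeasure_set_dirac)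

text \<open>A set that misses S sees only the Poisson points. With p the m-mass of V, the factorial
  moments turn k p + k (k - 1) p^2 into t p + (t p)^2, the second moment of a Poisson variable with
  parameter t p.\<close>

lemma BeP_moments:
  assumes V: "V \<in> sets borel" and disj: "V \<inter> S = {}"
  shows "(\<integral>\<^sup>+N. emeasure N V \<partial>BeP \<nu>) = ennreal t * emeasure m V"
    and "(\<integral>\<^sup>+N. (emeasure N V)\<^sup>2 \<partial>BeP \<nu>) = ennreal t * emeasure m V + (ennreal t * emeasure m V)\<^sup>2"
proof -
  have [measurable]: "V \<in> sets borel" by (rule V)
  have Vm: "V \<in> sets m" by (simp add: V sets_m)
  have "(\<Sum>x\<in>{x \<in> S. v x}. indicator V x :: ennreal) = 0" for v
    using disj by (intro sum.neutral) (auto simp: indicator_def)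
  then have eq: "emeasure (add_meas (sum_dirac k \<xi>) (set_dirac {x \<in> S. v x})) V = (\<Sum>i<k. indicator V (\<xi> i))" for k \<xi> v
    using V by (simp add: emeasure_BeP_sample)
  have one: "emeasure (PiM S (\<lambda>x. measure_pmf (bernoulli_pmf (measure \<nu> {x}))))
      (space (PiM S (\<lambda>x. measure_pmf (bernoulli_pmf (measure \<nu> {x}))))) = 1"
    by (intro prob_space.emeasure_space_1 prob_space_PiM measure_pmf.prob_space_axioms)
  have "(\<integral>\<^sup>+N. emeasure N V \<partial>BeP \<nu>) = (\<integral>\<^sup>+k. of_nat k * emeasure m V \<partial>poisson_pmf t)"
    by (subst nn_integral_BeP) (simp_all add: eq one iid_count_moments[OF m Vm])
  then show "(\<integral>\<^sup>+N. emeasure N V \<partial>BeP \<nu>) = ennreal t * emeasure m V"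
    using poisson_factorial_moments[OF t_pos] by (simp add: nn_integral_multc)
  have "(\<integral>\<^sup>+N. (emeasure N V)\<^sup>2 \<partial>BeP \<nu>) = (\<integral>\<^sup>+k. of_nat k * emeasure m V + of_nat (k * (k - 1)) * (emeasure m V)\<^sup>2 \<partial>poisson_pmf t)"
    by (subst nn_integral_BeP) (simp_all add: eq one iid_count_moments[OF m Vm])
  also have "\<dots> = ennreal t * emeasure m V + ennreal (t\<^sup>2) * (emeasure m V)\<^sup>2"
    using poisson_factorial_moments[OF t_pos] by (simp add: nn_integral_multc nn_integral_add del: of_nat_mult)
  finally show "(\<integral>\<^sup>+N. (emeasure N V)\<^sup>2 \<partial>BeP \<nu>) = ennreal t * emeasure m V + (ennreal t * emeasure m V)\<^sup>2"
    using t_pos by (simp add: power_mult_distrib ennreal_power)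
qed

text \<open>The sampled points are almost surely distinct and off S, so together with the chosen
  atoms they form a finite set in which nothing is counted twice.\<close>

lemma BeP_simple: "emeasure (BeP \<nu>) {N \<in> space FM. \<not> simple_measure N} = 0"
proof -
  have "emeasure (BeP \<nu>) {N \<in> space FM. \<not> simple_measure N}
    = (\<integral>\<^sup>+N. indicator {N \<in> space FM. \<not> simple_measure N} N \<partial>BeP \<nu>)"
    by (simp add: BeP_def)
  also have "\<dots> = (\<integral>\<^sup>+k. \<integral>\<^sup>+\<xi>. \<integral>\<^sup>+v. 
      indicator {N \<in> space FM. \<not> simple_measure N} (add_meas (sum_dirac k \<xi>) (set_dirac {x \<in> S. v x}))
      \<partial>PiM S (\<lambda>x. measure_pmf (bernoulli_pmf (measure \<nu> {x}))) \<partial>PiM {..<k} (\<lambda>_. m) \<partial>poisson_pmf t)"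
    by (rule nn_integral_BeP) measurable
  also have "\<dots> = (\<integral>\<^sup>+k. \<integral>\<^sup>+\<xi>. 0 \<partial>PiM {..<k} (\<lambda>_. m) \<partial>poisson_pmf t)"
  proof (rule nn_integral_cong, rule nn_integral_cong_AE)
    fix k
    show "AE \<xi> in PiM {..<k} (\<lambda>_. m). (\<integral>\<^sup>+v. 
      indicator {N \<in> space FM. \<not> simple_measure N} (add_meas (sum_dirac k \<xi>) (set_dirac {x \<in> S. v x}))
      \<partial>PiM S (\<lambda>x. measure_pmf (bernoulli_pmf (measure \<nu> {x})))) = 0"
      using AE_iid_distinct_avoiding[OF m sets_m diffuse finite_S, of k]
    proof eventually_elim
      case (elim \<xi>)
      have "simple_measure (add_meas (sum_dirac k \<xi>) (set_dirac {x \<in> S. v x}))" for v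
      proof (rule simple_measureI)
        fix B :: "'x set" assume B: "B \<in> sets borel"
        have "(\<Sum>i<k. indicator B (\<xi> i)) = (\<Sum>x\<in>\<xi> ` {..<k}. indicator B x :: ennreal)"
          using elim by (subst sum.reindex) auto
        moreover have "(\<Sum>x\<in>\<xi> ` {..<k}. indicator B x) + (\<Sum>x\<in>{x \<in> S. v x}. indicator B x)
          = (\<Sum>x\<in>\<xi> ` {..<k} \<union> {x \<in> S. v x}. indicator B x :: ennreal)"
          using elim finite_S by (intro sum.union_disjoint[symmetric]) auto
        ultimately show "emeasure (add_meas (sum_dirac k \<xi>) (set_dirac {x \<in> S. v x})) B
          = (\<Sum>x\<in>\<xi> ` {..<k} \<union> {x \<in> S. v x}. indicator B x)"
          using emeasure_BeP_sample[OF B] by simp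
      qed (use finite_S in auto)
      then show ?case by simp
    qed
  qed
  finally show ?thesis by simp
qed

end

section \<open>Growth rates\<close>

lemma pos_not_nonpos_Int: "x > 0 \<Longrightarrow> x \<notin> \<int>\<^sub>\<le>\<^sub>0" for x :: real
  by (auto elim!: nonpos_Ints_cases)

text \<open>Log-convexity is used between x and x + 1 with weight s, and Gamma (x + 1) = x Gamma x
  turns the right end point into a power of x.\<close>

lemma Gamma_shift_le:
  fixes x s :: real
  assumes x: "x > 0" and s: "0 \<le> s" "s \<le> 1"
  shows "Gamma (x + s) \<le> x powr s * Gamma x"
proof -
  have "(ln \<circ> Gamma) ((1 - s) *\<^sub>R x + s *\<^sub>R (x + 1)) \<le> (1 - s) * (ln \<circ> Gamma) x + s * (ln \<circ> Gamma) (x + 1)"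
    using assms by (intro convex_onD[OF log_convex_Gamma_real]) auto
  also have "(1 - s) *\<^sub>R x + s *\<^sub>R (x + 1) = x + s" by (simp add: algebra_simps)
  finally have "ln (Gamma (x + s)) \<le> (1 - s) * ln (Gamma x) + s * ln (Gamma (x + 1))" by simp
  also have "Gamma (x + 1) = x * Gamma x" using x by (intro Gamma_plus1) (auto elim!: nonpos_Ints_cases)
  also have "ln (x * Gamma x) = ln x + ln (Gamma x)" using x by (simp add: ln_mult_pos Gamma_real_pos)
  finally have "ln (Gamma (x + s)) \<le> s * ln x + ln (Gamma x)" by (simp add: algebra_simps)
  then have "exp (ln (Gamma (x + s))) \<le> exp (s * ln x + ln (Gamma x))" by simp
  then show ?thesis using assms by (simp add: exp_add powr_def Gamma_real_pos)
qed

text \<open>The reverse direction: the same bound applied at x + s with the complementary step 1 - s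
  leads to Gamma (x + 1). Being explicit in x, it later bounds \<Lambda>_n for every n and not just
  in the limit.\<close>

lemma Gamma_ratio_le:
  fixes x s :: real
  assumes x: "x > 0" and s: "0 \<le> s" "s \<le> 1"
  shows "Gamma x / Gamma (x + s) \<le> (1 + s / x) powr (1 - s) * x powr (- s)"
proof -
  have "x * Gamma x = Gamma ((x + s) + (1 - s))"
    using Gamma_plus1[of x] x pos_not_nonpos_Int[of x] by (simp add: algebra_simps)
  also have "\<dots> \<le> (x + s) powr (1 - s) * Gamma (x + s)" using assms by (intro Gamma_shift_le) auto
  also have "(x + s) powr (1 - s) = (1 + s / x) powr (1 - s) * (x powr (- s) * x)"
  proof -
    have "x + s = (1 + s / x) * x" using x by (simp add: field_simps)
    then show ?thesis using x s powr_add[of x "- s" 1] by (simp add: powr_mult)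
  qed
  finally show ?thesis using x s by (simp add: field_simps Gamma_real_pos)
qed

lemma Gamma_ratio_tendsto:
  fixes s :: real
  assumes s: "0 \<le> s" "s \<le> 1"
  shows "((\<lambda>x. Gamma x / Gamma (x + s) * x powr s) \<longlongrightarrow> 1) at_top"
proof (rule tendsto_sandwich)
  show "\<forall>\<^sub>F x in at_top. 1 \<le> Gamma x / Gamma (x + s) * x powr s"
    using eventually_gt_at_top[of 0]
  proof eventually_elim
    case (elim x)
    then show ?case using Gamma_shift_le[of x s] s by (simp add: field_simps Gamma_real_pos)
  qed
  show "\<forall>\<^sub>F x in at_top. Gamma x / Gamma (x + s) * x powr s \<le> (1 + s / x) powr (1 - s)"
    using eventually_gt_at_top[of 0]
  proof eventually_elim
    case (elim x)
    then have "Gamma x / Gamma (x + s) * x powr s \<le> ((1 + s / x) powr (1 - s) * x powr (- s)) * x powr s"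
      using Gamma_ratio_le[of x s] s by (intro mult_right_mono) auto
    then show ?case using elim by (simp add: powr_minus mult.assoc)
  qed
  have "((\<lambda>x. s / x) \<longlongrightarrow> 0) at_top" by real_asymp
  then have "((\<lambda>x. (1 + s / x) powr (1 - s)) \<longlongrightarrow> (1 + 0) powr (1 - s)) at_top"
    by (intro tendsto_intros) auto
  then show "((\<lambda>x. (1 + s / x) powr (1 - s)) \<longlongrightarrow> 1) at_top" by simp
qed simp

text \<open>After subtracting l times the increments, which telescope exactly because
  \<open>a 0 = 0\<close>, the limit to be shown is 0. The increments are asked to be positive only
  eventually, as ln 0 = ln 1 = 0 makes the first increment of the logarithmic scale vanish.\<close>

lemma stolz_cesaro:
  fixes a d :: "nat \<Rightarrow> real"
  assumes a: "filterlim a at_top sequentially" and a0: "a 0 = 0"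
    and inc: "\<forall>\<^sub>F n in sequentially. a n < a (Suc n)"
    and lim: "(\<lambda>n. d n / (a (Suc n) - a n)) \<longlonglongrightarrow> l"
  shows "(\<lambda>n. (\<Sum>j<n. d j) / a n) \<longlonglongrightarrow> l"
proof -
  define e where "e j = d j - l * (a (Suc j) - a j)" for j
  have tele: "(\<Sum>j<n. a (Suc j) - a j) = a n" for n
    using sum_lessThan_telescope[of a n] a0 by simp
  have sum_e: "(\<Sum>j<n. e j) = (\<Sum>j<n. d j) - l * a n" for n
    unfolding e_def sum_subtractf[of d] sum_distrib_left[symmetric] tele ..
  have "(\<lambda>n. (\<Sum>j<n. e j) / a n) \<longlonglongrightarrow> 0"
  proof (rule LIMSEQ_I)
    fix \<epsilon> :: real assume \<epsilon>: "\<epsilon> > 0"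
    have "\<forall>\<^sub>F n in sequentially. \<bar>d n / (a (Suc n) - a n) - l\<bar> < \<epsilon> / 2"
      using tendstoD[OF lim, of "\<epsilon> / 2"] \<epsilon> by (simp add: dist_real_def)
    with inc have "\<forall>\<^sub>F n in sequentially. \<bar>e n\<bar> \<le> \<epsilon> / 2 * (a (Suc n) - a n)"
    proof eventually_elim
      case (elim n)
      have "e n = (d n / (a (Suc n) - a n) - l) * (a (Suc n) - a n)"
        using elim by (simp add: e_def field_simps)
      then have "\<bar>e n\<bar> = \<bar>d n / (a (Suc n) - a n) - l\<bar> * (a (Suc n) - a n)"
        using elim by (simp add: abs_mult)
      also have "\<dots> \<le> \<epsilon> / 2 * (a (Suc n) - a n)" using elim by (intro mult_right_mono) auto
      finally show ?case .
    qed
    then obtain N where N: "\<And>n. n \<ge> N \<Longrightarrow> \<bar>e n\<bar> \<le> \<epsilon> / 2 * (a (Suc n) - a n)"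
      by (auto simp: eventually_sequentially)
    \<comment> \<open>The finite head of the sum, with a correction for the unknown sign of
      \<open>a N\<close>, is a constant that \<open>a n\<close> will dominate.\<close>
    define C where "C = \<bar>\<Sum>j<N. e j\<bar> + \<epsilon> / 2 * \<bar>a N\<bar>"
    have bound: "\<bar>\<Sum>j<n. e j\<bar> \<le> C + \<epsilon> / 2 * a n" if "n \<ge> N" for n
    proof -
      have split: "(\<Sum>j<n. f j) = (\<Sum>j<N. f j) + (\<Sum>j\<in>{N..<n}. f j)" for f :: "nat \<Rightarrow> real"
        using that by (simp add: lessThan_atLeast0 sum.atLeastLessThan_concat)
      have "\<bar>\<Sum>j\<in>{N..<n}. e j\<bar> \<le> (\<Sum>j\<in>{N..<n}. \<epsilon> / 2 * (a (Suc j) - a j))"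
        by (rule order_trans[OF sum_abs sum_mono]) (use N in auto)
      also have "\<dots> = \<epsilon> / 2 * (a n - a N)"
        using split[of "\<lambda>j. a (Suc j) - a j"] unfolding sum_distrib_left[symmetric] tele by simp
      finally have "\<bar>\<Sum>j<n. e j\<bar> \<le> \<bar>\<Sum>j<N. e j\<bar> + \<epsilon> / 2 * (a n - a N)"
        unfolding split[of e] by linarith
      also have "\<dots> \<le> C + \<epsilon> / 2 * a n"
        using \<epsilon> mult_left_mono[OF abs_ge_minus_self[of "a N"], of "\<epsilon> / 2"] by (simp add: C_def algebra_simps)
      finally show ?thesis .
    qed
    \<comment> \<open>Once \<open>a n\<close> exceeds 2 C / \<epsilon>, the constant C is less than
      half of \<epsilon> times \<open>a n\<close>.\<close>
    have "\<forall>\<^sub>F n in sequentially. a n > max 0 (2 * C / \<epsilon>)"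
      using a by (rule filterlim_at_top_dense[THEN iffD1, rule_format])
    then obtain N' where N': "\<And>n. n \<ge> N' \<Longrightarrow> a n > max 0 (2 * C / \<epsilon>)"
      by (auto simp: eventually_sequentially)
    have "norm ((\<Sum>j<n. e j) / a n - 0) < \<epsilon>" if n: "n \<ge> max N N'" for n
    proof -
      have an: "a n > 0" "2 * C / \<epsilon> < a n" using N'[of n] n by auto
      then have "C + \<epsilon> / 2 * a n < \<epsilon> * a n" using \<epsilon> by (simp add: field_simps)
      then have "\<bar>\<Sum>j<n. e j\<bar> < \<epsilon> * a n" using bound[of n] n by simp
      then show ?thesis using an by (simp add: field_simps)
    qed
    then show "\<exists>no. \<forall>n\<ge>no. norm ((\<Sum>j<n. e j) / a n - 0) < \<epsilon>" by blast
  qed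
  from tendsto_add[OF this tendsto_const[of l]]
  have "(\<lambda>n. (\<Sum>j<n. e j) / a n + l) \<longlonglongrightarrow> l" by simp
  moreover have "\<forall>\<^sub>F n in sequentially. (\<Sum>j<n. e j) / a n + l = (\<Sum>j<n. d j) / a n"
    using filterlim_at_top_dense[THEN iffD1, OF a, rule_format, of 0]
    by eventually_elim (simp add: sum_e field_simps)
  ultimately show ?thesis by (rule Lim_transform_eventually)
qed

section \<open>From a sparse subsequence to the whole sequence\<close>

definition square_level :: "(nat \<Rightarrow> real) \<Rightarrow> nat \<Rightarrow> nat" where
  "square_level a k = (LEAST n. (real k)\<^sup>2 \<le> a n)"

lemma square_level_ge:
  assumes "filterlim a at_top sequentially"
  shows "(real k)\<^sup>2 \<le> a (square_level a k)"
proof -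
  have "\<exists>n. (real k)\<^sup>2 \<le> a n"
    using filterlim_at_top[THEN iffD1, OF assms, rule_format, of "(real k)\<^sup>2"]
    by (auto simp: eventually_sequentially)
  then show ?thesis unfolding square_level_def by (rule LeastI_ex)
qed

text \<open>The index just before the level still lies below k^2, so the overshoot is at most one
  increment. If the level is index 0, the value is 0.\<close>

lemma square_level_le:
  assumes a: "filterlim a at_top sequentially" and a0: "a 0 = 0" and D: "\<And>n. a (Suc n) \<le> a n + D" "D \<ge> 0"
  shows "a (square_level a k) \<le> (real k)\<^sup>2 + D"
proof (cases "square_level a k")
  case 0
  then show ?thesis using a0 D by simp
next
  case (Suc n)
  then have "\<not> (real k)\<^sup>2 \<le> a n"
    using not_less_Least[of n "\<lambda>n. (real k)\<^sup>2 \<le> a n"] by (simp add: square_level_def)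
  then show ?thesis using D(1)[of n] Suc by simp
qed

lemma square_level_at_top:
  assumes a: "filterlim a at_top sequentially" and inc: "incseq a"
  shows "filterlim (square_level a) sequentially sequentially"
  unfolding filterlim_at_top
proof
  fix B
  have "filterlim (\<lambda>k. (real k)\<^sup>2) at_top sequentially" by real_asymp
  then have "\<forall>\<^sub>F k in sequentially. a B < (real k)\<^sup>2"
    by (simp add: filterlim_at_top_dense)
  then show "\<forall>\<^sub>F k in sequentially. B \<le> square_level a k"
  proof eventually_elim
    case (elim k)
    then have "a B < a (square_level a k)" using square_level_ge[OF a, of k] by linarith
    then show ?case using incseqD[OF inc, of "square_level a k" B] by (meson nle_le not_less)
  qed
qed

text \<open>With K the integer part of the square root of \<open>a n\<close>, the index n lies
  between the levels K and K + 1. Monotonicity traps \<open>L n / a n\<close> between the quotients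
  there, up to the factors K^2 / (K + 1)^2 and ((K + 1)^2 + D) / K^2, where D pays for the overshoot
  at the upper level.\<close>

lemma tendsto_from_square_levels:
  fixes a L :: "nat \<Rightarrow> real"
  assumes a: "filterlim a at_top sequentially" and a0: "a 0 = 0" and inc: "incseq a"
    and D: "\<And>n. a (Suc n) \<le> a n + D" "D \<ge> 0"
    and L: "incseq L" "\<And>n. 0 \<le> L n"
    and lim: "(\<lambda>k. L (square_level a k) / a (square_level a k)) \<longlonglongrightarrow> l"
  shows "(\<lambda>n. L n / a n) \<longlonglongrightarrow> l"
proof -
  define q where "q k = L (square_level a k) / a (square_level a k)" for k
  define K where "K n = nat \<lfloor>sqrt (a n)\<rfloor>" for n
  have a_nn: "0 \<le> a n" for n using incseqD[OF inc, of 0 n] a0 by simp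
  have K: "(real (K n))\<^sup>2 \<le> a n" "a n < (real (Suc (K n)))\<^sup>2" for n
  proof -
    have "real (K n) \<le> sqrt (a n)" "sqrt (a n) < real (Suc (K n))"
      using a_nn[of n] by (auto simp: K_def) linarith
    then show "(real (K n))\<^sup>2 \<le> a n" "a n < (real (Suc (K n)))\<^sup>2"
      using a_nn[of n] by (auto simp: real_le_rsqrt real_less_lsqrt power_mono real_sqrt_le_iff
         intro: real_sqrt_less_iff[THEN iffD1] simp del: of_nat_Suc
         dest: power_mono[of _ _ 2] power_strict_mono[of _ _ 2])
  qed
  have q_nn: "0 \<le> q k" for k using L a_nn by (simp add: q_def)
  \<comment> \<open>At level 0 the scale is 0 and the quotient forgets L by the convention x / 0 =
    0, hence the restriction to k > 0.\<close>
  have Lq: "L (square_level a k) = q k * a (square_level a k)" if "k > 0" for k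
  proof -
    have "0 < (real k)\<^sup>2" using that by simp
    then have "a (square_level a k) > 0" using square_level_ge[OF a, of k] by linarith
    then show ?thesis by (simp add: q_def)
  qed
  have lower: "q (K n) * ((real (K n))\<^sup>2 / (real (Suc (K n)))\<^sup>2) \<le> L n / a n"
    and upper: "L n / a n \<le> q (Suc (K n)) * (((real (Suc (K n)))\<^sup>2 + D) / (real (K n))\<^sup>2)"
    if "K n > 0" for n
  proof -
    have pos: "0 < (real (K n))\<^sup>2" using that by simp
    have an: "0 < a n" using K(1)[of n] pos by linarith
    have 1: "square_level a (K n) \<le> n" using K(1)[of n] by (simp add: square_level_def Least_le)
    have 2: "n \<le> square_level a (Suc (K n))"
    proof (rule ccontr)
      assume "\<not> ?thesis"
      then have "a (square_level a (Suc (K n))) \<le> a n" by (intro incseqD[OF inc]) auto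
      then show False using square_level_ge[OF a, of "Suc (K n)"] K(2)[of n] by linarith
    qed
    have "q (K n) * (real (K n))\<^sup>2 \<le> q (K n) * a (square_level a (K n))"
      using square_level_ge[OF a] q_nn by (intro mult_left_mono)
    also have "\<dots> = L (square_level a (K n))" using Lq[OF that] by simp
    also have "\<dots> \<le> L n" using 1 L(1) by (rule incseqD[rotated])
    finally have *: "q (K n) * (real (K n))\<^sup>2 \<le> L n" .
    have "q (K n) * ((real (K n))\<^sup>2 / (real (Suc (K n)))\<^sup>2) \<le> L n / (real (Suc (K n)))\<^sup>2"
      using divide_right_mono[OF *, of "(real (Suc (K n)))\<^sup>2"] by simp
    also have "\<dots> \<le> L n / a n" using K(2)[of n] an L(2)[of n] by (intro divide_left_mono) auto
    finally show "q (K n) * ((real (K n))\<^sup>2 / (real (Suc (K n)))\<^sup>2) \<le> L n / a n" .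
    have "L n \<le> L (square_level a (Suc (K n)))" using 2 L(1) by (rule incseqD[rotated])
    also have "\<dots> = q (Suc (K n)) * a (square_level a (Suc (K n)))" using Lq[of "Suc (K n)"] by simp
    also have "\<dots> \<le> q (Suc (K n)) * ((real (Suc (K n)))\<^sup>2 + D)"
      using square_level_le[OF a a0 D] q_nn by (intro mult_left_mono)
    finally have *: "L n \<le> q (Suc (K n)) * ((real (Suc (K n)))\<^sup>2 + D)" .
    have "L n / a n \<le> L n / (real (K n))\<^sup>2" using K(1)[of n] mult_pos_pos[OF an pos] L(2)[of n] by (intro divide_left_mono) auto
    also have "\<dots> \<le> q (Suc (K n)) * (((real (Suc (K n)))\<^sup>2 + D) / (real (K n))\<^sup>2)"
      using divide_right_mono[OF *, of "(real (K n))\<^sup>2"] by simp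
    finally show "L n / a n \<le> q (Suc (K n)) * (((real (Suc (K n)))\<^sup>2 + D) / (real (K n))\<^sup>2)" .
  qed
  have K_lim: "filterlim K sequentially sequentially"
    unfolding K_def
    by (intro filterlim_compose[OF filterlim_nat_sequentially] filterlim_compose[OF filterlim_floor_sequentially]
         filterlim_compose[OF sqrt_at_top] a)
  have q: "q \<longlonglongrightarrow> l" using lim by (simp add: q_def[abs_def])
  have "(\<lambda>k. (real k)\<^sup>2 / (real (Suc k))\<^sup>2) \<longlonglongrightarrow> 1" by real_asymp
  from tendsto_mult[OF q this] have lo: "(\<lambda>k. q k * ((real k)\<^sup>2 / (real (Suc k))\<^sup>2)) \<longlonglongrightarrow> l" by simp
  have "(\<lambda>k. ((real (Suc k))\<^sup>2 + D) / (real k)\<^sup>2) \<longlonglongrightarrow> 1" by real_asymp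
  from tendsto_mult[OF LIMSEQ_Suc[OF q] this]
  have up: "(\<lambda>k. q (Suc k) * (((real (Suc k))\<^sup>2 + D) / (real k)\<^sup>2)) \<longlonglongrightarrow> l" by simp
  have ev: "\<forall>\<^sub>F n in sequentially. K n > 0"
    using K_lim eventually_gt_at_top[of 0] by (rule filterlim_iff[THEN iffD1, rule_format])
  show ?thesis
  proof (rule tendsto_sandwich)
    show "\<forall>\<^sub>F n in sequentially. q (K n) * ((real (K n))\<^sup>2 / (real (Suc (K n)))\<^sup>2) \<le> L n / a n"
      using ev by eventually_elim (rule lower)
    show "\<forall>\<^sub>F n in sequentially. L n / a n \<le> q (Suc (K n)) * (((real (Suc (K n)))\<^sup>2 + D) / (real (K n))\<^sup>2)"
      using ev by eventually_elim (rule upper)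
  qed (use filterlim_compose[OF lo K_lim] filterlim_compose[OF up K_lim] in auto)
qed

section \<open>The two growth scales\<close>

definition growth :: "real \<Rightarrow> nat \<Rightarrow> real" where
  "growth \<beta> n = (if \<beta> = 0 then ln (real n) else real n powr \<beta>)"

context
  fixes \<beta> :: real
  assumes beta: "0 \<le> \<beta>" "\<beta> < 1"
begin

text \<open>Rests on the conventions ln 0 = 0 and 0 powr \<beta> = 0; it lets the increments of the
  scale add up exactly to the scale.\<close>

lemma growth_0: "growth \<beta> 0 = 0"
  by (simp add: growth_def)

lemma incseq_growth: "incseq (growth \<beta>)"
proof (rule incseq_SucI)
  fix n
  show "growth \<beta> n \<le> growth \<beta> (Suc n)"
    using beta by (cases "n = 0") (auto simp: growth_def intro!: powr_mono2)
qed

lemma growth_at_top: "filterlim (growth \<beta>) at_top sequentially"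
proof (cases "\<beta> = 0")
  case True
  have "filterlim (\<lambda>n. ln (real n)) at_top sequentially" by real_asymp
  then show ?thesis using True by (simp add: growth_def[abs_def])
next
  case False
  then have "\<beta> > 0" using beta by simp
  then have "filterlim (\<lambda>n. real n powr \<beta>) at_top sequentially" by real_asymp
  then show ?thesis using False by (simp add: growth_def[abs_def])
qed

text \<open>The increment behaves like 1 / n for the logarithm and like \<beta> n powr (\<beta> - 1)
  for the power, which is where the factor 1 / \<beta> of the limit comes from.\<close>

lemma growth_diff_asymp:
  "(\<lambda>n. real n powr (\<beta> - 1) / (growth \<beta> (Suc n) - growth \<beta> n)) \<longlonglongrightarrow> (if \<beta> = 0 then 1 else 1 / \<beta>)"
proof (cases "\<beta> = 0")
  case True
  have "(\<lambda>n. real n powr (- 1) / (ln (real (Suc n)) - ln (real n))) \<longlonglongrightarrow> 1" by real_asymp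
  then show ?thesis using True by (simp add: growth_def)
next
  case False
  then have "\<beta> > 0" using beta by simp
  then have "(\<lambda>n. real n powr (\<beta> - 1) / (real (Suc n) powr \<beta> - real n powr \<beta>)) \<longlonglongrightarrow> 1 / \<beta>"
    by (real_asymp simp: field_simps)
  then show ?thesis using False by (simp add: growth_def)
qed

lemma growth_diff_pos: "\<forall>\<^sub>F n in sequentially. growth \<beta> n < growth \<beta> (Suc n)"
  using eventually_gt_at_top[of 0]
  by eventually_elim (use beta in \<open>auto simp: growth_def intro!: powr_less_mono2\<close>)

lemma growth_diff_bounded: "\<exists>D\<ge>0. \<forall>n. growth \<beta> (Suc n) \<le> growth \<beta> n + D"
proof -
  have "(\<lambda>n. growth \<beta> (Suc n) - growth \<beta> n) \<longlonglongrightarrow> 0"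
  proof (cases "\<beta> = 0")
    case True
    have "(\<lambda>n. ln (real (Suc n)) - ln (real n)) \<longlonglongrightarrow> 0" by real_asymp
    then show ?thesis using True by (simp add: growth_def)
  next
    case False
    then have "\<beta> > 0" using beta by simp
    then have "(\<lambda>n. real (Suc n) powr \<beta> - real n powr \<beta>) \<longlonglongrightarrow> 0" using beta by real_asymp
    then show ?thesis using False by (simp add: growth_def)
  qed
  then have "Bseq (\<lambda>n. growth \<beta> (Suc n) - growth \<beta> n)"
    by (intro convergent_imp_Bseq convergentI)
  then obtain D where "D > 0" "\<And>n. \<bar>growth \<beta> (Suc n) - growth \<beta> n\<bar> \<le> D"
    by (auto elim!: BseqE)
  then show ?thesis by (intro exI[of _ D]) (auto simp: abs_le_iff algebra_simps)
qed

text \<open>Serves twice, for the random \<Lambda>_j and for their deterministic majorant, both of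
  order n powr (\<beta> - 1).\<close>

lemma sum_powr_growth:
  "(\<lambda>n. (\<Sum>j<n. d j) / growth \<beta> n) \<longlonglongrightarrow> l * (if \<beta> = 0 then 1 else 1 / \<beta>)"
  if d: "(\<lambda>n. d n / real n powr (\<beta> - 1)) \<longlonglongrightarrow> l"
proof (rule stolz_cesaro[OF growth_at_top growth_0 growth_diff_pos])
  have "(\<lambda>n. d n / real n powr (\<beta> - 1) * (real n powr (\<beta> - 1) / (growth \<beta> (Suc n) - growth \<beta> n)))
    \<longlonglongrightarrow> l * (if \<beta> = 0 then 1 else 1 / \<beta>)"
    by (intro tendsto_mult d growth_diff_asymp)
  moreover have "\<forall>\<^sub>F n in sequentially. d n / real n powr (\<beta> - 1) * (real n powr (\<beta> - 1) / (growth \<beta> (Suc n) - growth \<beta> n))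
     = d n / (growth \<beta> (Suc n) - growth \<beta> n)"
    using eventually_gt_at_top[of 0] by eventually_elim auto
  ultimately show "(\<lambda>n. d n / (growth \<beta> (Suc n) - growth \<beta> n)) \<longlonglongrightarrow> l * (if \<beta> = 0 then 1 else 1 / \<beta>)"
    by (rule Lim_transform_eventually)
qed

end

text \<open>The argument x = b + \<open>\<rho> n\<close> is asymptotic to r n, so Gamma x / Gamma (x
  + s) behaves like x powr (- s), hence like (r n) powr (- s).\<close>

lemma Gamma_ratio_along_linear:
  fixes \<rho> :: "nat \<Rightarrow> real"
  assumes s: "0 \<le> s" "s \<le> 1" and r: "r > 0" and \<rho>: "(\<lambda>n. \<rho> n / real n) \<longlonglongrightarrow> r"
  shows "(\<lambda>n. (Gamma (b + \<rho> n) / Gamma (b + \<rho> n + s)) / real n powr (- s)) \<longlonglongrightarrow> r powr (- s)"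
proof -
  have "(\<lambda>n. b / real n + \<rho> n / real n) \<longlonglongrightarrow> 0 + r"
    by (intro tendsto_add \<rho>) real_asymp
  then have x: "(\<lambda>n. (b + \<rho> n) / real n) \<longlonglongrightarrow> r" by (simp add: add_divide_distrib)
  have "filterlim (\<lambda>n. (b + \<rho> n) / real n * real n) at_top sequentially"
    by (rule filterlim_tendsto_pos_mult_at_top[OF x r filterlim_real_sequentially])
  then have top: "filterlim (\<lambda>n. b + \<rho> n) at_top sequentially"
    by (rule filterlim_mono_eventually[OF _ order.refl order.refl])
       (use eventually_gt_at_top[of 0] in eventually_elim, simp)
  have "(\<lambda>n. (Gamma (b + \<rho> n) / Gamma (b + \<rho> n + s) * (b + \<rho> n) powr s) * ((b + \<rho> n) / real n) powr (- s)) \<longlonglongrightarrow> r powr (- s)"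
    using tendsto_mult[OF filterlim_compose[OF Gamma_ratio_tendsto[OF s] top] tendsto_powr[OF x tendsto_const[of "- s"]]] r
    by simp
  moreover have "\<forall>\<^sub>F n in sequentially. (Gamma (b + \<rho> n) / Gamma (b + \<rho> n + s) * (b + \<rho> n) powr s) * ((b + \<rho> n) / real n) powr (- s)
     = (Gamma (b + \<rho> n) / Gamma (b + \<rho> n + s)) / real n powr (- s)"
    using eventually_gt_at_top[of 0] filterlim_at_top_dense[THEN iffD1, OF top, rule_format, of 0]
    by eventually_elim (simp add: powr_divide powr_minus field_simps)
  ultimately show ?thesis by (rule Lim_transform_eventually)
qed

section \<open>The conditional law of the next measure\<close>

text \<open>Conditional monotone convergence: by ordinary monotone convergence the supremum of the
  conditional expectations has the right integral over every set of F.\<close>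

lemma (in sigma_finite_subalgebra) nn_cond_exp_SUP:
  assumes [measurable]: "\<And>i::nat. f i \<in> borel_measurable M" and inc: "\<And>x. x \<in> space M \<Longrightarrow> incseq (\<lambda>i. f i x)"
  shows "AE x in M. (SUP i. nn_cond_exp M F (f i) x) = nn_cond_exp M F (\<lambda>x. SUP i. f i x) x"
proof (rule nn_cond_exp_charact)
  fix A assume A[measurable]: "A \<in> sets F"
  then have AM[measurable]: "A \<in> sets M" by (meson subalg subalgebra_def subsetD)
  have "(\<integral>\<^sup>+x\<in>A. (SUP i. f i x) \<partial>M) = (\<integral>\<^sup>+x. (SUP i. f i x * indicator A x) \<partial>M)"
    by (simp add: SUP_mult_right_ennreal)
  also have "\<dots> = (SUP i. \<integral>\<^sup>+x\<in>A. f i x \<partial>M)"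
    using inc by (intro nn_integral_monotone_convergence_SUP_AE)
      (auto intro!: AE_I2 mult_right_mono dest: incseq_SucD)
  also have "\<dots> = (SUP i. \<integral>\<^sup>+x\<in>A. nn_cond_exp M F (f i) x \<partial>M)"
    using nn_cond_exp_intg[of "indicator A" "f _"] by (simp add: mult.commute)
  also have "\<dots> = (\<integral>\<^sup>+x. (SUP i. nn_cond_exp M F (f i) x * indicator A x) \<partial>M)"
  proof (rule nn_integral_monotone_convergence_SUP_AE[symmetric])
    fix i
    have "AE x in M. nn_cond_exp M F (f i) x \<le> nn_cond_exp M F (f (Suc i)) x"
      using inc by (intro nn_cond_exp_mono) (auto intro!: AE_I2 dest: incseq_SucD)
    then show "AE x in M. nn_cond_exp M F (f i) x * indicator A x \<le> nn_cond_exp M F (f (Suc i)) x * indicator A x"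
      by eventually_elim (rule mult_right_mono, auto)
  qed simp
  also have "\<dots> = (\<integral>\<^sup>+x\<in>A. (SUP i. nn_cond_exp M F (f i) x) \<partial>M)"
    by (simp add: SUP_mult_right_ennreal)
  finally show "(\<integral>\<^sup>+x\<in>A. (SUP i. f i x) \<partial>M) = (\<integral>\<^sup>+x\<in>A. (SUP i. nn_cond_exp M F (f i) x) \<partial>M)" .
qed auto

text \<open>\<open>real_cond_exp\<close> passes through \<open>enn2real\<close> and subtracts a
  negative part. For an indicator that part is 0 and the conditional expectation is almost surely at
  most 1, so no infinite value is lost.\<close>

lemma (in sigma_finite_subalgebra) nn_cond_exp_indicator_eq:
  assumes [measurable]: "B \<in> sets M"
  shows "AE x in M. nn_cond_exp M F (indicator B) x = ennreal (real_cond_exp M F (indicator B) x)"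
proof -
  have eq: "(\<lambda>x. ennreal (- indicator B x)) = (\<lambda>_. 0)" "(\<lambda>x. ennreal (indicator B x)) = indicator B"
    by (auto simp: indicator_def ennreal_neg fun_eq_iff)
  have "AE x in M. nn_cond_exp M F (indicator B) x \<le> nn_cond_exp M F (\<lambda>_. 1) x"
    by (rule nn_cond_exp_mono) (auto simp: indicator_def)
  moreover have "AE x in M. 1 = nn_cond_exp M F (\<lambda>_. 1) x" "AE x in M. 0 = nn_cond_exp M F (\<lambda>_. 0) x"
    by (rule nn_cond_exp_F_meas; simp)+
  ultimately show ?thesis
    unfolding real_cond_exp_def eq
    by eventually_elim (metis diff_zero enn2real_0 ennreal_enn2real ennreal_one_less_top order_le_less_trans)
qed

text \<open>The measurability of the kernel \<open>\<omega> \<mapsto> BeP (\<nu> \<omega>)\<close> need not be shown: up to null sets it is part of \<open>cond\<close>.\<close>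
lemma cond_BeP_nn_cond_exp:
  assumes "sigma_finite_subalgebra P G"
    and X[measurable]: "X \<in> measurable P (FM :: 'x::topological_space measure measure)"
    and cond: "cond_BeP P G X \<nu>"
    and prob: "\<And>\<omega>. \<omega> \<in> space P \<Longrightarrow> prob_space (BeP (\<nu> \<omega>))"
    and f: "f \<in> borel_measurable (FM :: 'x measure measure)"
  shows "AE \<omega> in P. nn_cond_exp P G (\<lambda>\<omega>. f (X \<omega>)) \<omega> = (\<integral>\<^sup>+N. f N \<partial>BeP (\<nu> \<omega>))"
proof -
  interpret sigma_finite_subalgebra P G by fact
  have sets_BeP[measurable_cong]: "sets (BeP (\<nu> \<omega>)) = sets FM" for \<omega> by (simp add: BeP_def)
  have space_BeP: "space (BeP (\<nu> \<omega>)) = space FM" for \<omega> by (simp add: BeP_def)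
  have X_space: "\<omega> \<in> space P \<Longrightarrow> X \<omega> \<in> space FM" for \<omega> using measurable_space[OF X] .
  show ?thesis using f
  proof induct
    case (cong f g)
    have eq: "(\<integral>\<^sup>+N. f N \<partial>BeP (\<nu> \<omega>)) = (\<integral>\<^sup>+N. g N \<partial>BeP (\<nu> \<omega>))" for \<omega>
      using cong(3) by (intro nn_integral_cong) (simp add: space_BeP)
    note [measurable] = cong(1,2)
    have "AE \<omega> in P. nn_cond_exp P G (\<lambda>\<omega>. f (X \<omega>)) \<omega> = nn_cond_exp P G (\<lambda>\<omega>. g (X \<omega>)) \<omega>"
      using cong(3) by (intro nn_cond_exp_cong AE_I2) (simp_all add: X_space)
    then show ?case using cong(4) unfolding eq by eventually_elim simp
  next
    case (set A)
    have [measurable]: "{\<omega> \<in> space P. X \<omega> \<in> A} \<in> sets P" using set by measurable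
    have "AE \<omega> in P. nn_cond_exp P G (\<lambda>\<omega>. indicator A (X \<omega>)) \<omega> = nn_cond_exp P G (indicator {\<omega> \<in> space P. X \<omega> \<in> A}) \<omega>"
      using set by (intro nn_cond_exp_cong) (auto simp: indicator_def)
    moreover have "AE \<omega> in P. nn_cond_exp P G (indicator {\<omega> \<in> space P. X \<omega> \<in> A}) \<omega>
        = ennreal (real_cond_exp P G (indicator {\<omega> \<in> space P. X \<omega> \<in> A}) \<omega>)"
      by (rule nn_cond_exp_indicator_eq) simp
    moreover have "AE \<omega> in P. real_cond_exp P G (indicator {\<omega> \<in> space P. X \<omega> \<in> A}) \<omega> = measure (BeP (\<nu> \<omega>)) A"
      using cond set by (simp add: cond_BeP_def)
    ultimately show ?case using AE_space
    proof eventually_elim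
      case (elim \<omega>)
      interpret B: prob_space "BeP (\<nu> \<omega>)" using prob elim by simp
      show ?case using elim set by (simp add: B.emeasure_eq_measure)
    qed
  next
    case (mult u c)
    note [measurable] = mult(2)
    have "AE \<omega> in P. c * nn_cond_exp P G (\<lambda>\<omega>. u (X \<omega>)) \<omega> = nn_cond_exp P G (\<lambda>\<omega>. c * u (X \<omega>)) \<omega>"
      by (rule nn_cond_exp_prod) auto
    then show ?case using mult(4) by eventually_elim (simp add: nn_integral_cmult)
  next
    case (add u v)
    note [measurable] = add(1,4)
    have "AE \<omega> in P. nn_cond_exp P G (\<lambda>\<omega>. v (X \<omega>)) \<omega> + nn_cond_exp P G (\<lambda>\<omega>. u (X \<omega>)) \<omega>
        = nn_cond_exp P G (\<lambda>\<omega>. v (X \<omega>) + u (X \<omega>)) \<omega>"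
      by (rule nn_cond_exp_sum) auto
    then show ?case using add(3,7) by eventually_elim (simp add: nn_integral_add)
  next
    case (seq U)
    note [measurable] = seq(1)
    have inc: "incseq (\<lambda>i. U i x)" for x using seq(4) by (auto simp: incseq_def le_fun_def)
    have "AE \<omega> in P. (SUP i. nn_cond_exp P G (\<lambda>\<omega>. U i (X \<omega>)) \<omega>) = nn_cond_exp P G (\<lambda>\<omega>. SUP i. U i (X \<omega>)) \<omega>"
      using inc by (intro nn_cond_exp_SUP) auto
    moreover have "AE \<omega> in P. \<forall>i. nn_cond_exp P G (\<lambda>\<omega>. U i (X \<omega>)) \<omega> = (\<integral>\<^sup>+N. U i N \<partial>BeP (\<nu> \<omega>))"
      using seq(3) by (simp add: AE_all_countable)
    ultimately show ?case
    proof eventually_elim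
      case (elim \<omega>)
      have "(\<integral>\<^sup>+N. (SUP i. U i N) \<partial>BeP (\<nu> \<omega>)) = (SUP i. \<integral>\<^sup>+N. U i N \<partial>BeP (\<nu> \<omega>))"
        by (rule nn_integral_monotone_convergence_SUP) (use seq(4) in auto)
      then show ?case using elim by (simp add: image_comp)
    qed
  qed
qed

text \<open>In a monotone sequence the product of the members i and j is at most the square of the
  member with index \<open>max i j\<close>; this also covers infinite values.\<close>

lemma SUP_power2_ennreal:
  fixes x :: "nat \<Rightarrow> ennreal"
  assumes "incseq x"
  shows "(SUP k. x k)\<^sup>2 = (SUP k. (x k)\<^sup>2)"
proof (rule antisym)
  have "x i * x j \<le> (SUP k. (x k)\<^sup>2)" for i j
  proof -
    have "x i * x j \<le> (x (max i j))\<^sup>2"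
      unfolding power2_eq_square using assms by (intro mult_mono) (auto simp: incseq_def)
    also have "\<dots> \<le> (SUP k. (x k)\<^sup>2)" by (rule SUP_upper) simp
    finally show ?thesis .
  qed
  then have "(SUP i. SUP j. x i * x j) \<le> (SUP k. (x k)\<^sup>2)" by (intro SUP_least)
  then show "(SUP k. x k)\<^sup>2 \<le> (SUP k. (x k)\<^sup>2)"
    by (subst (asm) SUP_commute) (simp add: power2_eq_square SUP_mult_left_ennreal SUP_mult_right_ennreal)
  show "(SUP k. (x k)\<^sup>2) \<le> (SUP k. x k)\<^sup>2"
    by (intro SUP_least power_mono SUP_upper) auto
qed

section \<open>The model and its filtration\<close>

locale weighted_buffet =
  fixes P :: "'w measure"
    and m :: "'x::{metric_space, second_countable_topology} measure"
    and Ms :: "nat \<Rightarrow> 'w \<Rightarrow> 'x measure"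
    and R :: "nat \<Rightarrow> 'w \<Rightarrow> real"
    and \<alpha> \<beta> c u :: real
  assumes P: "prob_space P"
    and m_prob: "prob_space m" and m_sets: "sets m = sets borel"
    and m_diffuse: "\<And>x. emeasure m {x} = 0"
    and \<alpha>: "\<alpha> > 0" and \<beta>: "0 \<le> \<beta>" "\<beta> < 1" and c: "c > - \<beta>"
    and M_rm: "\<And>n. n \<ge> 1 \<Longrightarrow> random_measure P (Ms n)"
    and R_meas: "\<And>n. n \<ge> 1 \<Longrightarrow> R n \<in> borel_measurable P"
    and u: "u > max \<beta> 0" and R_ge: "\<And>n \<omega>. n \<ge> 1 \<Longrightarrow> \<omega> \<in> space P \<Longrightarrow> R n \<omega> \<ge> u"
    and BeP_step: "\<And>n. cond_BeP P (gen_sigma P Ms R {1..n} {1..n})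
                           (Ms (Suc n)) (hazard m \<alpha> \<beta> c Ms R n)"
begin

sublocale P: prob_space P by (rule P)
sublocale m: prob_space m by (rule m_prob)

text \<open>At n = 0 both index ranges are empty, so this is the trivial sigma-field and the first
  step is treated like all others.\<close>

definition \<F> :: "nat \<Rightarrow> 'w measure" where "\<F> n = gen_sigma P Ms R {1..n} {1..n}"
abbreviation "S \<equiv> feat_set Ms"
abbreviation "\<Lambda> \<equiv> Lam \<alpha> \<beta> c R"

lemma Ms_measurable [measurable]: "i \<ge> 1 \<Longrightarrow> Ms i \<in> measurable P FM"
  using M_rm by (intro measurable_FM_I) (auto simp: random_measure_def space_FM)

lemma Ms_FM: "i \<ge> 1 \<Longrightarrow> \<omega> \<in> space P \<Longrightarrow> Ms i \<omega> \<in> space FM"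
  by (rule measurable_space[OF Ms_measurable])

lemma space_filtration [simp]: "space (\<F> n) = space P"
  by (simp add: \<F>_def gen_sigma_def space_measure_of_conv)

lemma sets_filtration:
  "sets (\<F> n) = sigma_sets (space P)
     ((\<Union>i\<in>{1..n}. {Ms i -` A \<inter> space P | A. A \<in> sets FM}) \<union>
      (\<Union>j\<in>{1..n}. {R j -` A \<inter> space P | A. A \<in> sets borel}))"
  unfolding \<F>_def gen_sigma_def by (intro sets_measure_of) auto

lemma subalgebra_filtration: "subalgebra P (\<F> n)"
  unfolding subalgebra_def sets_filtration
proof (intro conjI sets.sigma_sets_subset Un_least UN_least subsetI)
  fix i B assume i: "i \<in> {1..n}"
  show "B \<in> {Ms i -` A \<inter> space P |A. A \<in> sets FM} \<Longrightarrow> B \<in> sets P"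
    using measurable_sets[OF Ms_measurable[of i]] i by auto
  show "B \<in> {R i -` A \<inter> space P |A. A \<in> sets borel} \<Longrightarrow> B \<in> sets P"
    using measurable_sets[OF R_meas[of i]] i by auto
qed simp

sublocale filtr: finite_measure_subalgebra P "\<F> n" for n
  by unfold_locales (rule subalgebra_filtration)

lemma measurable_filtration_P: "f \<in> measurable (\<F> n) N \<Longrightarrow> f \<in> measurable P N"
  by (rule measurable_from_subalg[OF subalgebra_filtration])

lemma Ms_adapted: "i \<in> {1..n} \<Longrightarrow> Ms i \<in> measurable (\<F> n) FM"
  by (rule measurableI; unfold sets_filtration space_filtration) (auto intro: Ms_FM intro!: sigma_sets.Basic)

lemma R_adapted: "i \<in> {1..n} \<Longrightarrow> R i \<in> borel_measurable (\<F> n)"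
  by (rule measurableI; unfold sets_filtration space_filtration) (auto intro!: sigma_sets.Basic)

lemma finite_S: "\<omega> \<in> space P \<Longrightarrow> finite (S n \<omega>)"
proof -
  assume "\<omega> \<in> space P"
  then have "finite (\<Union>i\<in>{1..n}. {x. emeasure (Ms i \<omega>) {x} = 1})"
    by (intro finite_UN_I finite_unit_points Ms_FM) auto
  moreover have "S n \<omega> = (\<Union>i\<in>{1..n}. {x. emeasure (Ms i \<omega>) {x} = 1})" by (auto simp: feat_set_def)
  ultimately show ?thesis by simp
qed

lemma weight_sum_ge: "\<omega> \<in> space P \<Longrightarrow> real n * u \<le> (\<Sum>i=1..n. R i \<omega>)"
  using sum_bounded_below[of "{1..n}" u "\<lambda>i. R i \<omega>"] R_ge by auto

lemma weight_sum_nonneg: "\<omega> \<in> space P \<Longrightarrow> 0 \<le> (\<Sum>i=1..n. R i \<omega>)"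
  using weight_sum_ge[of \<omega> n] u by (intro order_trans[OF mult_nonneg_nonneg[of "real n" u] weight_sum_ge]) auto

lemma Lam_pos: "\<omega> \<in> space P \<Longrightarrow> \<Lambda> n \<omega> > 0"
  using weight_sum_nonneg[of \<omega> n] \<alpha> \<beta> c by (simp add: Lam_def Gamma_real_pos)

text \<open>A feature in S_n was chosen at some step i, so the numerator is at least R_i - \<beta>
  >= u - \<beta> > 0. The denominator exceeds u - \<beta> because c > -\<beta>; c itself may be
  negative. As \<open>atoms\<close> asks for positive mass, no member of S_n is missing from the
  atoms of the hazard measure.\<close>

lemma feature_weight_pos:
  assumes \<omega>: "\<omega> \<in> space P" and x: "x \<in> S n \<omega>"
  shows "((\<Sum>i=1..n. R i \<omega> * measure (Ms i \<omega>) {x}) - \<beta>) / ((\<Sum>i=1..n. R i \<omega>) + c) > 0"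
proof -
  obtain i where i: "i \<in> {1..n}" "emeasure (Ms i \<omega>) {x} = 1" using x by (auto simp: feat_set_def)
  have Rn: "0 \<le> R j \<omega>" if "j \<in> {1..n}" for j using R_ge[of j \<omega>] \<omega> u that by simp
  have "u \<le> R i \<omega> * measure (Ms i \<omega>) {x}" using i R_ge[of i \<omega>] \<omega> by (simp add: measure_def)
  also have "\<dots> \<le> (\<Sum>i=1..n. R i \<omega> * measure (Ms i \<omega>) {x})"
    using i Rn by (intro member_le_sum) auto
  finally have 1: "\<beta> < (\<Sum>i=1..n. R i \<omega> * measure (Ms i \<omega>) {x})" using u by simp
  have "u \<le> R i \<omega>" using i R_ge[of i \<omega>] \<omega> by simp
  also have "\<dots> \<le> (\<Sum>i=1..n. R i \<omega>)" using i Rn by (intro member_le_sum) auto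
  finally have "0 < (\<Sum>i=1..n. R i \<omega>) + c" using u c by simp
  with 1 show ?thesis by simp
qed

lemma emeasure_hazard:
  assumes \<omega>: "\<omega> \<in> space P" and A: "A \<in> sets borel"
  shows "emeasure (hazard m \<alpha> \<beta> c Ms R n \<omega>) A =
    (\<Sum>x\<in>S n \<omega> \<inter> A. ennreal (((\<Sum>i=1..n. R i \<omega> * measure (Ms i \<omega>) {x}) - \<beta>) / ((\<Sum>i=1..n. R i \<omega>) + c)))
          + ennreal (\<Lambda> n \<omega>) * emeasure m A"
proof -
  define w where "w x = ennreal (((\<Sum>i=1..n. R i \<omega> * measure (Ms i \<omega>) {x}) - \<beta>) / ((\<Sum>i=1..n. R i \<omega>) + c))" for x
  have eq: "(\<Sum>x\<in>S n \<omega> \<inter> A. w x) = (\<Sum>x\<in>S n \<omega>. w x * indicator A x)" for A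
    using finite_S[OF \<omega>] by (simp add: sum.inter_restrict indicator_def if_distrib cong: if_cong)
  have "countably_additive (sets borel) (\<lambda>A. (\<Sum>x\<in>S n \<omega>. w x * indicator A x) + ennreal (\<Lambda> n \<omega>) * emeasure m A)"
  proof (rule countably_additiveI)
    fix A :: "nat \<Rightarrow> 'x set" assume A: "range A \<subseteq> sets borel" "disjoint_family A" "\<Union> (range A) \<in> sets borel"
    have 1: "(\<Sum>i. \<Sum>x\<in>S n \<omega>. w x * indicator (A i) x) = (\<Sum>x\<in>S n \<omega>. w x * indicator (\<Union>i. A i) x)"
      using A countably_additive_weighted_points[OF finite_S[OF \<omega>], of "sets borel" w "\<lambda>x. x" n]
      by (simp add: countably_additive_def)
    have 2: "(\<Sum>i. ennreal (\<Lambda> n \<omega>) * emeasure m (A i)) = ennreal (\<Lambda> n \<omega>) * emeasure m (\<Union>i. A i)"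
      using A by (simp add: suminf_emeasure m_sets ennreal_suminf_cmult)
    show "(\<Sum>i. (\<Sum>x\<in>S n \<omega>. w x * indicator (A i) x) + ennreal (\<Lambda> n \<omega>) * emeasure m (A i)) =
      (\<Sum>x\<in>S n \<omega>. w x * indicator (\<Union>i. A i) x) + ennreal (\<Lambda> n \<omega>) * emeasure m (\<Union>i. A i)"
      by (subst suminf_add[symmetric]) (simp_all only: 1 2 summableI)
  qed
  then show ?thesis
    unfolding hazard_def w_def[symmetric] eq using A
    by (subst emeasure_measure_of_borel) auto
qed

lemma mixed_hazard_hazard:
  assumes \<omega>: "\<omega> \<in> space P"
  shows "mixed_hazard (hazard m \<alpha> \<beta> c Ms R n \<omega>) m (S n \<omega>) (\<Lambda> n \<omega>)"
proof
  show "sets (hazard m \<alpha> \<beta> c Ms R n \<omega>) = sets borel" by (simp add: hazard_def)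
  have S_borel: "S n \<omega> \<in> sets borel" using finite_imp_closed[OF finite_S[OF \<omega>]] by simp
  show "atoms (hazard m \<alpha> \<beta> c Ms R n \<omega>) = S n \<omega>"
  proof (rule set_eqI)
    fix x
    show "x \<in> atoms (hazard m \<alpha> \<beta> c Ms R n \<omega>) \<longleftrightarrow> x \<in> S n \<omega>"
      using feature_weight_pos[OF \<omega>, of x n] m_diffuse
      by (cases "x \<in> S n \<omega>") (simp_all add: atoms_def emeasure_hazard[OF \<omega>])
  qed
  fix A :: "'x set" assume A: "A \<in> sets borel"
  have null: "S n \<omega> \<in> null_sets m"
    using null_sets_UN'[of "S n \<omega>" "\<lambda>x. {x}" m] m_diffuse finite_S[OF \<omega>]
    by (auto simp: null_sets_def m_sets countable_finite)
  have "S n \<omega> \<inter> (A - S n \<omega>) = {}" by auto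
  then show "emeasure (hazard m \<alpha> \<beta> c Ms R n \<omega>) (A - S n \<omega>) = ennreal (\<Lambda> n \<omega>) * emeasure m A"
    using A S_borel null by (simp add: emeasure_hazard[OF \<omega>] emeasure_Diff_null_set m_sets)
qed (use finite_S[OF \<omega>] Lam_pos[OF \<omega>] m_sets m_diffuse in auto)

lemma prob_space_BeP_hazard: "\<omega> \<in> space P \<Longrightarrow> prob_space (BeP (hazard m \<alpha> \<beta> c Ms R n \<omega>))"
  by (rule mixed_hazard.prob_space_BeP[OF mixed_hazard_hazard])

text \<open>The conditional law as it is applied: a weight known at time n times a fixed function of
  the next measure.\<close>

lemma nn_integral_step:
  assumes [measurable]: "h \<in> borel_measurable (\<F> n)" "f \<in> borel_measurable FM"
  shows "(\<integral>\<^sup>+\<omega>. h \<omega> * f (Ms (Suc n) \<omega>) \<partial>P) = (\<integral>\<^sup>+\<omega>. h \<omega> * (\<integral>\<^sup>+N. f N \<partial>BeP (hazard m \<alpha> \<beta> c Ms R n \<omega>)) \<partial>P)"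
proof -
  have "(\<integral>\<^sup>+\<omega>. h \<omega> * f (Ms (Suc n) \<omega>) \<partial>P) = (\<integral>\<^sup>+\<omega>. h \<omega> * nn_cond_exp P (\<F> n) (\<lambda>\<omega>. f (Ms (Suc n) \<omega>)) \<omega> \<partial>P)"
    by (rule filtr.nn_cond_exp_intg[symmetric]) measurable
  also have "\<dots> = (\<integral>\<^sup>+\<omega>. h \<omega> * (\<integral>\<^sup>+N. f N \<partial>BeP (hazard m \<alpha> \<beta> c Ms R n \<omega>)) \<partial>P)"
  proof (rule nn_integral_cong_AE)
    have "AE \<omega> in P. nn_cond_exp P (\<F> n) (\<lambda>\<omega>. f (Ms (Suc n) \<omega>)) \<omega> = (\<integral>\<^sup>+N. f N \<partial>BeP (hazard m \<alpha> \<beta> c Ms R n \<omega>))"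
      by (rule cond_BeP_nn_cond_exp[OF _ _ BeP_step[folded \<F>_def]]) (auto simp: prob_space_BeP_hazard filtr.sigma_finite_subalgebra_axioms)
    then show "AE \<omega> in P. h \<omega> * nn_cond_exp P (\<F> n) (\<lambda>\<omega>. f (Ms (Suc n) \<omega>)) \<omega> =
       h \<omega> * (\<integral>\<^sup>+N. f N \<partial>BeP (hazard m \<alpha> \<beta> c Ms R n \<omega>))"
      by eventually_elim simp
  qed
  finally show ?thesis .
qed

lemma AE_simple: "AE \<omega> in P. \<forall>i\<ge>1. simple_measure (Ms i \<omega>)"
proof -
  have "AE \<omega> in P. simple_measure (Ms (Suc n) \<omega>)" for n
  proof -
    define A :: "'x measure set" where "A = {N \<in> space FM. \<not> simple_measure N}"
    have A[measurable]: "A \<in> sets FM" unfolding A_def by measurable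
    have "emeasure P {\<omega> \<in> space P. \<not> simple_measure (Ms (Suc n) \<omega>)} = (\<integral>\<^sup>+\<omega>. indicator {\<omega> \<in> space P. \<not> simple_measure (Ms (Suc n) \<omega>)} \<omega> \<partial>P)"
      by (rule nn_integral_indicator[symmetric]) measurable
    also have "\<dots> = (\<integral>\<^sup>+\<omega>. 1 * indicator A (Ms (Suc n) \<omega>) \<partial>P)"
      by (intro nn_integral_cong) (auto simp: A_def indicator_def Ms_FM)
    also have "\<dots> = (\<integral>\<^sup>+\<omega>. 1 * (\<integral>\<^sup>+N. indicator A N \<partial>BeP (hazard m \<alpha> \<beta> c Ms R n \<omega>)) \<partial>P)"
      by (rule nn_integral_step) auto
    also have "\<dots> = (\<integral>\<^sup>+\<omega>. 0 \<partial>P)"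
    proof (rule nn_integral_cong)
      fix \<omega> assume "\<omega> \<in> space P"
      then show "1 * (\<integral>\<^sup>+N. indicator A N \<partial>BeP (hazard m \<alpha> \<beta> c Ms R n \<omega>)) = 0"
        using mixed_hazard.BeP_simple[OF mixed_hazard_hazard] A by (simp add: A_def BeP_def)
    qed
    finally show ?thesis by (intro AE_I[OF subset_refl]) auto
  qed
  then have "AE \<omega> in P. \<forall>n. simple_measure (Ms (Suc n) \<omega>)" by (simp add: AE_all_countable)
  then show ?thesis by eventually_elim (metis Suc_le_D One_nat_def)
qed

end

section \<open>Mass on the unoccupied region\<close>

context weighted_buffet
begin

text \<open>Brings \<Lambda>_n to the shape Gamma x / Gamma (x + s) with s = 1 - \<beta>, to which
  the Gamma bounds apply.\<close>

lemma Lam_eq: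
  "\<Lambda> n \<omega> = \<alpha> * Gamma (c + 1) / Gamma (c + \<beta>) *
     (Gamma (c + \<beta> + (\<Sum>i=1..n. R i \<omega>)) / Gamma (c + \<beta> + (\<Sum>i=1..n. R i \<omega>) + (1 - \<beta>)))"
  by (simp add: Lam_def algebra_simps)

lemma Lam_adapted: "\<Lambda> n \<in> borel_measurable (\<F> n)"
proof -
  define g :: "real \<Rightarrow> real" where "g x = Gamma (c + \<beta> + x) / Gamma (c + \<beta> + x + (1 - \<beta>))" for x
  have "continuous_on {0..} g"
    unfolding g_def
  proof (intro continuous_at_imp_continuous_on ballI isCont_divide isCont_Gamma)
    fix x :: real assume "x \<in> {0..}"
    then have "0 < c + \<beta> + x" "0 < c + \<beta> + x + (1 - \<beta>)" using \<beta> c by auto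
    then show "c + \<beta> + x \<notin> \<int>\<^sub>\<le>\<^sub>0" "c + \<beta> + x + (1 - \<beta>) \<notin> \<int>\<^sub>\<le>\<^sub>0" "Gamma (c + \<beta> + x + (1 - \<beta>)) \<noteq> 0"
      using pos_not_nonpos_Int by (auto simp: Gamma_eq_zero_iff)
  qed auto
  \<comment> \<open>Gamma is continuous only away from its poles. Cutting off below 0 keeps g
    measurable on the whole line and changes nothing at the sum of the weights, which is
    nonnegative.\<close>
  then have g: "(\<lambda>x. indicator {0..} x *\<^sub>R g x) \<in> borel_measurable borel"
    by (intro borel_measurable_continuous_on_indicator) auto
  have R: "(\<lambda>\<omega>. \<Sum>i=1..n. R i \<omega>) \<in> borel_measurable (\<F> n)"
    by (intro borel_measurable_sum R_adapted)
  have "(\<lambda>\<omega>. \<alpha> * Gamma (c + 1) / Gamma (c + \<beta>) * (indicator {0..} (\<Sum>i=1..n. R i \<omega>) *\<^sub>R g (\<Sum>i=1..n. R i \<omega>))) \<in> borel_measurable (\<F> n)"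
    by (intro borel_measurable_times measurable_const measurable_compose[OF R g]) auto
  then show ?thesis
    by (rule measurable_cong[THEN iffD1, rotated]) (use weight_sum_nonneg[of _ n] in \<open>simp add: Lam_eq g_def\<close>)
qed

lemma Lam_measurable [measurable]: "\<Lambda> n \<in> borel_measurable P"
  by (rule measurable_filtration_P[OF Lam_adapted])

definition free_cells :: "nat \<Rightarrow> nat \<Rightarrow> 'w \<Rightarrow> 'x set set" where
  "free_cells n k \<omega> = {C \<in> range (cell k). \<forall>i\<in>{1..n}. emeasure (Ms i \<omega>) C = 0}"

text \<open>Almost surely the complement of \<open>S n\<close>. Exhausting it by unions of free cells, which take only
  finitely many values at each level, turns the mass that the next measure puts on this random set
  into masses of deterministic sets.\<close>
definition free_region :: "nat \<Rightarrow> 'w \<Rightarrow> 'x set" where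
  "free_region n \<omega> = (\<Union>k. \<Union>(free_cells n k \<omega>))"

text \<open>A mass instead of a number of points, because the conditional law controls masses of
  sets; \<open>card_S_eq\<close> identifies it with the number of new features wherever all measures
  are simple.\<close>

definition new_mass :: "nat \<Rightarrow> 'w \<Rightarrow> real" where
  "new_mass n \<omega> = measure (Ms (Suc n) \<omega>) (free_region n \<omega>)"

lemma mem_free_cells: "x \<in> \<Union>(free_cells n k \<omega>) \<longleftrightarrow> (\<forall>i\<in>{1..n}. emeasure (Ms i \<omega>) (cell k x) = 0)"
  using cell_eq[of x k] by (auto simp: free_cells_def)

lemma Union_cells_borel: "\<C> \<subseteq> range (cell k) \<Longrightarrow> \<Union>\<C> \<in> sets borel"
  by (intro sets.finite_Union finite_subset[OF _ finite_cells]) auto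

lemma free_cells_borel: "\<Union>(free_cells n k \<omega>) \<in> sets borel"
  by (rule Union_cells_borel[of _ k]) (auto simp: free_cells_def)

lemma incseq_free_cells:
  assumes "\<omega> \<in> space P"
  shows "incseq (\<lambda>k. \<Union>(free_cells n k \<omega>))"
proof (rule incseq_SucI, rule subsetI, unfold mem_free_cells, rule ballI)
  fix k x i assume x: "\<forall>i\<in>{1..n}. emeasure (Ms i \<omega>) (cell k x) = 0" and i: "i \<in> {1..n}"
  have "sets (Ms i \<omega>) = sets borel" using Ms_FM[of i \<omega>] assms i by (simp add: space_FM)
  then show "emeasure (Ms i \<omega>) (cell (Suc k) x) = 0"
    using emeasure_eq_0[OF _ bspec[OF x i] cell_antimono[of k "Suc k" x]] by simp
qed

lemma free_cells_disjoint:
  assumes "\<omega> \<in> space P"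
  shows "\<Union>(free_cells n k \<omega>) \<inter> S n \<omega> = {}"
proof (rule ccontr)
  assume "\<not> ?thesis"
  then obtain x i where x: "\<forall>i\<in>{1..n}. emeasure (Ms i \<omega>) (cell k x) = 0" and i: "i \<in> {1..n}" "emeasure (Ms i \<omega>) {x} = 1"
    unfolding feat_set_def disjoint_iff mem_free_cells by blast
  have "sets (Ms i \<omega>) = sets borel" using Ms_FM[of i \<omega>] assms i by (simp add: space_FM)
  then have "emeasure (Ms i \<omega>) {x} = 0" using emeasure_eq_0[OF _ bspec[OF x i(1)], of "{x}"] by simp
  with i show False by simp
qed

lemma emeasure_free_region:
  assumes "\<omega> \<in> space P" "sets N = sets borel"
  shows "(SUP k. emeasure N (\<Union>(free_cells n k \<omega>))) = emeasure N (free_region n \<omega>)"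
  unfolding free_region_def using incseq_free_cells[OF assms(1)] free_cells_borel assms(2)
  by (intro SUP_emeasure_incseq) auto

lemma incseq_emeasure_free_cells:
  assumes "\<omega> \<in> space P" "sets N = sets borel"
  shows "incseq (\<lambda>k. emeasure N (\<Union>(free_cells n k \<omega>)))"
  unfolding incseq_def
  by (intro allI impI emeasure_mono incseqD[OF incseq_free_cells[OF assms(1)]]) (simp_all add: assms(2) free_cells_borel)

lemma free_region_borel: "free_region n \<omega> \<in> sets borel"
  unfolding free_region_def using free_cells_borel by auto

lemma free_cells_adapted: "{\<omega> \<in> space P. free_cells n k \<omega> = \<C>} \<in> sets (\<F> n)"
proof (cases "\<C> \<subseteq> range (cell k)")
  case True
  have "{\<omega> \<in> space P. free_cells n k \<omega> = \<C>} =
    {\<omega> \<in> space (\<F> n). \<forall>C\<in>range (cell k). (\<forall>i\<in>{1..n}. emeasure (Ms i \<omega>) C = 0) \<longleftrightarrow> C \<in> \<C>}"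
    using True by (auto simp: free_cells_def)
  also have "\<dots> \<in> sets (\<F> n)"
  proof -
    have "Measurable.pred (\<F> n) (\<lambda>\<omega>. emeasure (Ms i \<omega>) C = 0)" if "C \<in> range (cell k)" "i \<in> {1..n}" for C i
    proof -
      have [measurable]: "C \<in> sets borel" using that by auto
      have [measurable]: "Ms i \<in> measurable (\<F> n) FM" using that by (intro Ms_adapted)
      show ?thesis by measurable
    qed
    then show ?thesis
      by (intro predE pred_intros_finite finite_cells pred_intros_logic) auto
  qed
  finally show ?thesis .
next
  case False
  then have "{\<omega> \<in> space P. free_cells n k \<omega> = \<C>} = {}" by (auto simp: free_cells_def)
  then show ?thesis by (metis sets.empty_sets)
qed

lemma free_cells_measurable [measurable]: "{\<omega> \<in> space P. free_cells n k \<omega> = \<C>} \<in> sets P"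
  using free_cells_adapted[of n k \<C>] subalgebra_filtration[of n] by (meson subalgebra_def subsetD)

text \<open>Splits according to the value of the random family, so that f meets only fixed
  families.\<close>

lemma sum_free_cells_indicator:
  assumes "\<omega> \<in> space P"
  shows "(\<Sum>\<C>\<in>Pow (range (cell k)). indicator {\<omega> \<in> space P. free_cells n k \<omega> = \<C>} \<omega> * f \<C>) = (f (free_cells n k \<omega>) :: ennreal)"
proof -
  have "free_cells n k \<omega> \<in> Pow (range (cell k))" by (auto simp: free_cells_def)
  then have "(\<Sum>\<C>\<in>Pow (range (cell k)). if \<C> = free_cells n k \<omega> then f \<C> else 0) = f (free_cells n k \<omega>)"
    using finite_cells by (subst sum.delta) auto
  moreover have "indicator {\<omega> \<in> space P. free_cells n k \<omega> = \<C>} \<omega> * f \<C> = (if \<C> = free_cells n k \<omega> then f \<C> else 0)" for \<C>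
    using assms by (auto simp: indicator_def)
  ultimately show ?thesis by simp
qed

text \<open>On the event that the free cells form the family \<C>, the union of \<C> is a
  deterministic Borel set that misses S_n. The event lies in the past, so its indicator joins the
  weight h and the conditional law applies to each of the finitely many families. Later \<phi> is
  the identity or the square, and \<psi> the moment that belongs to it.\<close>

lemma free_cells_moment:
  assumes h: "h \<in> borel_measurable (\<F> n)" and \<phi>[measurable]: "\<phi> \<in> borel_measurable (borel :: ennreal measure)"
    and \<psi>[measurable]: "\<And>V. V \<in> sets borel \<Longrightarrow> (\<lambda>\<omega>. \<psi> \<omega> V) \<in> borel_measurable P"
    and eq: "\<And>\<omega> V. \<omega> \<in> space P \<Longrightarrow> V \<in> sets borel \<Longrightarrow> V \<inter> S n \<omega> = {} \<Longrightarrow>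
      (\<integral>\<^sup>+N. \<phi> (emeasure N V) \<partial>BeP (hazard m \<alpha> \<beta> c Ms R n \<omega>)) = \<psi> \<omega> V"
  shows "(\<integral>\<^sup>+\<omega>. h \<omega> * \<phi> (emeasure (Ms (Suc n) \<omega>) (\<Union>(free_cells n k \<omega>))) \<partial>P) = (\<integral>\<^sup>+\<omega>. h \<omega> * \<psi> \<omega> (\<Union>(free_cells n k \<omega>)) \<partial>P)"
proof -
  define I where "I \<C> = (indicator {\<omega> \<in> space P. free_cells n k \<omega> = \<C>} :: 'w \<Rightarrow> ennreal)" for \<C>
  have I[measurable]: "I \<C> \<in> borel_measurable P" for \<C> unfolding I_def by measurable
  have IF: "I \<C> \<in> borel_measurable (\<F> n)" for \<C> unfolding I_def using free_cells_adapted by simp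
  have [measurable]: "h \<in> borel_measurable P" by (rule measurable_filtration_P[OF h])
  have U: "\<Union>\<C> \<in> sets borel" if "\<C> \<in> Pow (range (cell k))" for \<C> :: "'x set set"
    using that Union_cells_borel by auto
  have [measurable]: "(\<lambda>N. emeasure N (\<Union>\<C>)) \<in> borel_measurable FM" if "\<C> \<in> Pow (range (cell k))" for \<C> :: "'x set set"
    using U[OF that] by measurable
  have "(\<integral>\<^sup>+\<omega>. h \<omega> * \<phi> (emeasure (Ms (Suc n) \<omega>) (\<Union>(free_cells n k \<omega>))) \<partial>P)
     = (\<integral>\<^sup>+\<omega>. (\<Sum>\<C>\<in>Pow (range (cell k)). (h \<omega> * I \<C> \<omega>) * \<phi> (emeasure (Ms (Suc n) \<omega>) (\<Union>\<C>))) \<partial>P)"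
    by (intro nn_integral_cong) (simp add: I_def mult.assoc sum_distrib_left[symmetric] sum_free_cells_indicator)
  also have "\<dots> = (\<Sum>\<C>\<in>Pow (range (cell k)). \<integral>\<^sup>+\<omega>. (h \<omega> * I \<C> \<omega>) * \<phi> (emeasure (Ms (Suc n) \<omega>) (\<Union>\<C>)) \<partial>P)"
    by (intro nn_integral_sum) measurable
  also have "\<dots> = (\<Sum>\<C>\<in>Pow (range (cell k)). \<integral>\<^sup>+\<omega>. (h \<omega> * I \<C> \<omega>) * \<psi> \<omega> (\<Union>\<C>) \<partial>P)"
  proof (rule sum.cong[OF refl])
    fix \<C> :: "'x set set" assume \<C>: "\<C> \<in> Pow (range (cell k))"
    have "(\<integral>\<^sup>+\<omega>. (h \<omega> * I \<C> \<omega>) * \<phi> (emeasure (Ms (Suc n) \<omega>) (\<Union>\<C>)) \<partial>P)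
      = (\<integral>\<^sup>+\<omega>. (h \<omega> * I \<C> \<omega>) * (\<integral>\<^sup>+N. \<phi> (emeasure N (\<Union>\<C>)) \<partial>BeP (hazard m \<alpha> \<beta> c Ms R n \<omega>)) \<partial>P)"
      by (intro nn_integral_step borel_measurable_times_ennreal h IF
            measurable_compose[OF measurable_emeasure_FM[OF U[OF \<C>]] \<phi>])
    also have "\<dots> = (\<integral>\<^sup>+\<omega>. (h \<omega> * I \<C> \<omega>) * \<psi> \<omega> (\<Union>\<C>) \<partial>P)"
    proof (rule nn_integral_cong)
      fix \<omega> assume \<omega>: "\<omega> \<in> space P"
      show "(h \<omega> * I \<C> \<omega>) * (\<integral>\<^sup>+N. \<phi> (emeasure N (\<Union>\<C>)) \<partial>BeP (hazard m \<alpha> \<beta> c Ms R n \<omega>)) = (h \<omega> * I \<C> \<omega>) * \<psi> \<omega> (\<Union>\<C>)"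
      \<comment> \<open>Where the families differ the indicator kills both sides, so
        \<open>eq\<close> is invoked only for sets disjoint from S_n.\<close>
      proof (cases "free_cells n k \<omega> = \<C>")
        case True
        then show ?thesis using eq[OF \<omega> U[OF \<C>]] free_cells_disjoint[OF \<omega>, of n k] by simp
      qed (simp add: I_def)
    qed
    finally show "(\<integral>\<^sup>+\<omega>. (h \<omega> * I \<C> \<omega>) * \<phi> (emeasure (Ms (Suc n) \<omega>) (\<Union>\<C>)) \<partial>P) = (\<integral>\<^sup>+\<omega>. (h \<omega> * I \<C> \<omega>) * \<psi> \<omega> (\<Union>\<C>) \<partial>P)" .
  qed
  also have "\<dots> = (\<integral>\<^sup>+\<omega>. (\<Sum>\<C>\<in>Pow (range (cell k)). (h \<omega> * I \<C> \<omega>) * \<psi> \<omega> (\<Union>\<C>)) \<partial>P)"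
    by (intro nn_integral_sum[symmetric] borel_measurable_times_ennreal \<psi> U) measurable
  also have "\<dots> = (\<integral>\<^sup>+\<omega>. h \<omega> * \<psi> \<omega> (\<Union>(free_cells n k \<omega>)) \<partial>P)"
    by (intro nn_integral_cong) (simp add: I_def mult.assoc sum_distrib_left[symmetric] sum_free_cells_indicator)
  finally show ?thesis .
qed

text \<open>Q will be P itself or a member of the filtration, and f the next measure or the constant
  m.\<close>

lemma measurable_emeasure_free_cells:
  assumes "f \<in> measurable Q FM" "space Q = space P" "\<And>\<C>. {\<omega> \<in> space P. free_cells n k \<omega> = \<C>} \<in> sets Q"
  shows "(\<lambda>\<omega>. emeasure (f \<omega>) (\<Union>(free_cells n k \<omega>))) \<in> borel_measurable Q"
proof -
  have "(\<lambda>\<omega>. \<Sum>\<C>\<in>Pow (range (cell k)). indicator {\<omega> \<in> space P. free_cells n k \<omega> = \<C>} \<omega> * emeasure (f \<omega>) (\<Union>\<C>)) \<in> borel_measurable Q"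
  proof (intro borel_measurable_sum borel_measurable_times_ennreal)
    fix \<C> :: "'x set set" assume "\<C> \<in> Pow (range (cell k))"
    then have "\<Union>\<C> \<in> sets borel" using Union_cells_borel by auto
    then show "(\<lambda>\<omega>. emeasure (f \<omega>) (\<Union>\<C>)) \<in> borel_measurable Q"
      using measurable_compose[OF assms(1) measurable_emeasure_FM] by simp
  qed (use assms(3) in simp)
  then show ?thesis
    by (rule measurable_cong[THEN iffD1, rotated]) (simp add: assms(2) sum_free_cells_indicator)
qed

text \<open>Simplicity gives the inclusion from right to left: a small cell around a point off S_n
  contains no earlier unit point, and a simple measure has all its mass in such points, so the cell
  is free.\<close>

lemma free_region_eq:
  assumes \<omega>: "\<omega> \<in> space P" and simple: "\<forall>i\<ge>1. simple_measure (Ms i \<omega>)"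
  shows "free_region n \<omega> = - S n \<omega>"
proof (rule equalityI)
  show "free_region n \<omega> \<subseteq> - S n \<omega>"
    using free_cells_disjoint[OF \<omega>] by (auto simp: free_region_def disjoint_iff)
  show "- S n \<omega> \<subseteq> free_region n \<omega>"
  proof
    fix x assume x: "x \<in> - S n \<omega>"
    have "\<forall>\<^sub>F k in sequentially. S n \<omega> \<inter> cell k x \<subseteq> {x}"
      by (rule eventually_cell_Int_finite[OF finite_S[OF \<omega>]])
    then obtain k where "S n \<omega> \<inter> cell k x \<subseteq> {x}" by (auto simp: eventually_sequentially)
    with x have k: "S n \<omega> \<inter> cell k x = {}" by auto
    have "emeasure (Ms i \<omega>) (cell k x) = 0" if i: "i \<in> {1..n}" for i
    proof -
      have "cell k x \<inter> {y. emeasure (Ms i \<omega>) {y} = 1} = {}" using k i unfolding feat_set_def by blast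
      then show ?thesis
        using simple_measure_count[OF Ms_FM[OF _ \<omega>], of i "cell k x"] simple i by simp
    qed
    then show "x \<in> free_region n \<omega>" unfolding free_region_def UN_iff mem_free_cells by blast
  qed
qed

lemma emeasure_m_free_region:
  assumes "\<omega> \<in> space P" "\<forall>i\<ge>1. simple_measure (Ms i \<omega>)"
  shows "emeasure m (free_region n \<omega>) = 1"
proof -
  have "S n \<omega> \<in> null_sets m"
    using null_sets_UN'[of "S n \<omega>" "\<lambda>x. {x}" m] m_diffuse finite_S[OF assms(1)]
    by (auto simp: null_sets_def m_sets countable_finite)
  moreover have "- S n \<omega> = space m - S n \<omega>" using sets_eq_imp_space_eq[OF m_sets] by auto
  ultimately show ?thesis
    using free_region_eq[OF assms] by (simp add: emeasure_Diff_null_set m.emeasure_space_1)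
qed

lemma card_S_eq:
  assumes \<omega>: "\<omega> \<in> space P" and simple: "\<forall>i\<ge>1. simple_measure (Ms i \<omega>)"
  shows "real (card (S n \<omega>)) = (\<Sum>j<n. new_mass j \<omega>)"
proof (induction n)
  case 0
  then show ?case by (simp add: feat_set_def)
next
  case (Suc n)
  define D where "D = {x. emeasure (Ms (Suc n) \<omega>) {x} = 1}"
  have D: "finite D" unfolding D_def using Ms_FM[OF _ \<omega>] by (intro finite_unit_points) auto
  have "S (Suc n) \<omega> = S n \<omega> \<union> (- S n \<omega> \<inter> D)"
    by (auto simp: feat_set_def D_def atLeastAtMostSuc_conv)
  then have "card (S (Suc n) \<omega>) = card (S n \<omega>) + card (- S n \<omega> \<inter> D)"
    using D finite_S[OF \<omega>] by (simp, subst card_Un_disjoint) auto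
  moreover have "new_mass n \<omega> = real (card (- S n \<omega> \<inter> D))"
    using simple_measure_count[OF Ms_FM[OF _ \<omega>], of "Suc n" "free_region n \<omega>"] simple free_region_borel[of n \<omega>]
    by (simp add: new_mass_def measure_def free_region_eq[OF \<omega> simple] D_def)
  ultimately show ?case using Suc by simp
qed

lemma emeasure_new_mass:
  assumes "\<omega> \<in> space P"
  shows "emeasure (Ms (Suc n) \<omega>) (free_region n \<omega>) = ennreal (new_mass n \<omega>)"
proof -
  interpret finite_measure "Ms (Suc n) \<omega>" using Ms_FM[OF _ assms, of "Suc n"] by (simp add: space_FM)
  show ?thesis by (simp add: new_mass_def emeasure_eq_measure)
qed

lemma new_mass_nonneg: "0 \<le> new_mass n \<omega>"
  by (simp add: new_mass_def)

lemma new_mass_adapted: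
  assumes "n < l"
  shows "new_mass n \<in> borel_measurable (\<F> l)"
proof -
  have "sets (\<F> n) \<subseteq> sets (\<F> l)"
    unfolding sets_filtration using assms by (intro sigma_sets_mono' Un_mono UN_mono) auto
  then have "(\<lambda>\<omega>. emeasure (Ms (Suc n) \<omega>) (\<Union>(free_cells n k \<omega>))) \<in> borel_measurable (\<F> l)" for k
    using assms free_cells_adapted by (intro measurable_emeasure_free_cells Ms_adapted) auto
  then have "(\<lambda>\<omega>. enn2real (SUP k. emeasure (Ms (Suc n) \<omega>) (\<Union>(free_cells n k \<omega>)))) \<in> borel_measurable (\<F> l)"
    by measurable
  then show ?thesis
  proof (rule measurable_cong[THEN iffD1, rotated])
    fix \<omega> assume "\<omega> \<in> space (\<F> l)"
    then have \<omega>: "\<omega> \<in> space P" by simp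
    have "sets (Ms (Suc n) \<omega>) = sets borel" using Ms_FM[OF _ \<omega>, of "Suc n"] by (simp add: space_FM)
    then show "enn2real (SUP k. emeasure (Ms (Suc n) \<omega>) (\<Union>(free_cells n k \<omega>))) = new_mass n \<omega>"
      by (simp add: emeasure_free_region[OF \<omega>] new_mass_def measure_def)
  qed
qed

lemma new_mass_measurable [measurable]: "new_mass n \<in> borel_measurable P"
  using new_mass_adapted[OF lessI] by (rule measurable_filtration_P)

lemma new_mass_SUP:
  assumes \<omega>: "\<omega> \<in> space P"
  shows "ennreal (new_mass n \<omega>) = (SUP k. emeasure (Ms (Suc n) \<omega>) (\<Union>(free_cells n k \<omega>)))"
    and "incseq (\<lambda>k. emeasure (Ms (Suc n) \<omega>) (\<Union>(free_cells n k \<omega>)))"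
proof -
  have s: "sets (Ms (Suc n) \<omega>) = sets borel" using Ms_FM[OF _ \<omega>, of "Suc n"] by (simp add: space_FM)
  show "ennreal (new_mass n \<omega>) = (SUP k. emeasure (Ms (Suc n) \<omega>) (\<Union>(free_cells n k \<omega>)))"
    using emeasure_free_region[OF \<omega> s] emeasure_new_mass[OF \<omega>] by simp
  show "incseq (\<lambda>k. emeasure (Ms (Suc n) \<omega>) (\<Union>(free_cells n k \<omega>)))"
    by (rule incseq_emeasure_free_cells[OF \<omega> s])
qed

lemma measurable_mass_free_cells [measurable]:
  "(\<lambda>\<omega>. emeasure (Ms (Suc n) \<omega>) (\<Union>(free_cells n k \<omega>))) \<in> borel_measurable P"
  by (intro measurable_emeasure_free_cells) auto

text \<open>Monotone convergence on both sides of the moment identity for the free cells. On the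
  right the m-masses increase to 1, since almost surely the free region omits only the finite set
  S_n.\<close>

lemma new_mass_first_moment:
  assumes h: "h \<in> borel_measurable (\<F> n)"
  shows "(\<integral>\<^sup>+\<omega>. h \<omega> * ennreal (new_mass n \<omega>) \<partial>P) = (\<integral>\<^sup>+\<omega>. h \<omega> * ennreal (\<Lambda> n \<omega>) \<partial>P)"
proof -
  have [measurable]: "h \<in> borel_measurable P" by (rule measurable_filtration_P[OF h])
  have m_FM: "m \<in> space FM" using m_sets m.finite_measure_axioms by (simp add: space_FM)
  have [measurable]: "(\<lambda>\<omega>. emeasure m (\<Union>(free_cells n k \<omega>))) \<in> borel_measurable P" for k
    by (intro measurable_emeasure_free_cells) (auto simp: m_FM)
  have m_inc: "incseq (\<lambda>k. emeasure m (\<Union>(free_cells n k \<omega>)))" if "\<omega> \<in> space P" for \<omega>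
    by (rule incseq_emeasure_free_cells[OF that m_sets])
  have "(\<integral>\<^sup>+\<omega>. h \<omega> * ennreal (new_mass n \<omega>) \<partial>P) = (\<integral>\<^sup>+\<omega>. (SUP k. h \<omega> * emeasure (Ms (Suc n) \<omega>) (\<Union>(free_cells n k \<omega>))) \<partial>P)"
    by (intro nn_integral_cong) (simp add: new_mass_SUP(1) SUP_mult_left_ennreal)
  also have "\<dots> = (SUP k. \<integral>\<^sup>+\<omega>. h \<omega> * emeasure (Ms (Suc n) \<omega>) (\<Union>(free_cells n k \<omega>)) \<partial>P)"
    using incseq_SucD[OF new_mass_SUP(2)]
    by (intro nn_integral_monotone_convergence_SUP_AE AE_I2 mult_left_mono) auto
  also have "\<dots> = (SUP k. \<integral>\<^sup>+\<omega>. h \<omega> * (ennreal (\<Lambda> n \<omega>) * emeasure m (\<Union>(free_cells n k \<omega>))) \<partial>P)"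
    by (intro SUP_cong refl free_cells_moment[OF h, where \<phi>="\<lambda>x. x" and \<psi>="\<lambda>\<omega> V. ennreal (\<Lambda> n \<omega>) * emeasure m V"])
       (auto intro!: mixed_hazard.BeP_moments(1)[OF mixed_hazard_hazard])
  also have "\<dots> = (\<integral>\<^sup>+\<omega>. (SUP k. h \<omega> * (ennreal (\<Lambda> n \<omega>) * emeasure m (\<Union>(free_cells n k \<omega>)))) \<partial>P)"
    using incseq_SucD[OF m_inc]
    by (intro nn_integral_monotone_convergence_SUP_AE[symmetric] AE_I2 mult_left_mono) auto
  also have "\<dots> = (\<integral>\<^sup>+\<omega>. h \<omega> * ennreal (\<Lambda> n \<omega>) \<partial>P)"
    using AE_simple AE_space
    by (intro nn_integral_cong_AE, eventually_elim)
       (simp add: SUP_mult_left_ennreal[symmetric] emeasure_free_region m_sets emeasure_m_free_region)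
  finally show ?thesis .
qed

text \<open>An upper bound is enough for the variance, so the m-mass of the free cells is estimated
  by 1 at each level instead of being followed to the limit.\<close>

lemma new_mass_second_moment:
  "(\<integral>\<^sup>+\<omega>. ennreal ((new_mass n \<omega>)\<^sup>2) \<partial>P) \<le> (\<integral>\<^sup>+\<omega>. ennreal (\<Lambda> n \<omega> + (\<Lambda> n \<omega>)\<^sup>2) \<partial>P)"
proof -
  have "(\<integral>\<^sup>+\<omega>. ennreal ((new_mass n \<omega>)\<^sup>2) \<partial>P) = (\<integral>\<^sup>+\<omega>. (SUP k. (emeasure (Ms (Suc n) \<omega>) (\<Union>(free_cells n k \<omega>)))\<^sup>2) \<partial>P)"
    by (intro nn_integral_cong)
       (simp add: ennreal_power[symmetric] new_mass_nonneg new_mass_SUP SUP_power2_ennreal)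
  also have "\<dots> = (SUP k. \<integral>\<^sup>+\<omega>. (emeasure (Ms (Suc n) \<omega>) (\<Union>(free_cells n k \<omega>)))\<^sup>2 \<partial>P)"
    using incseq_SucD[OF new_mass_SUP(2)]
    by (intro nn_integral_monotone_convergence_SUP_AE AE_I2 power_mono) auto
  also have "\<dots> \<le> (\<integral>\<^sup>+\<omega>. ennreal (\<Lambda> n \<omega> + (\<Lambda> n \<omega>)\<^sup>2) \<partial>P)"
  proof (rule SUP_least)
    fix k
    have "(\<integral>\<^sup>+\<omega>. (emeasure (Ms (Suc n) \<omega>) (\<Union>(free_cells n k \<omega>)))\<^sup>2 \<partial>P) =
      (\<integral>\<^sup>+\<omega>. 1 * (emeasure (Ms (Suc n) \<omega>) (\<Union>(free_cells n k \<omega>)))\<^sup>2 \<partial>P)" by simp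
    also have "\<dots> = (\<integral>\<^sup>+\<omega>. 1 * (ennreal (\<Lambda> n \<omega>) * emeasure m (\<Union>(free_cells n k \<omega>)) + (ennreal (\<Lambda> n \<omega>) * emeasure m (\<Union>(free_cells n k \<omega>)))\<^sup>2) \<partial>P)"
      by (intro free_cells_moment[where \<phi>="\<lambda>x. x\<^sup>2" and
            \<psi>="\<lambda>\<omega> V. ennreal (\<Lambda> n \<omega>) * emeasure m V + (ennreal (\<Lambda> n \<omega>) * emeasure m V)\<^sup>2"])
         (auto intro!: mixed_hazard.BeP_moments(2)[OF mixed_hazard_hazard])
    also have "\<dots> \<le> (\<integral>\<^sup>+\<omega>. ennreal (\<Lambda> n \<omega> + (\<Lambda> n \<omega>)\<^sup>2) \<partial>P)"
    proof (rule nn_integral_mono)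
      fix \<omega> assume \<omega>: "\<omega> \<in> space P"
      define p where "p = emeasure m (\<Union>(free_cells n k \<omega>))"
      have "ennreal (\<Lambda> n \<omega>) * p \<le> ennreal (\<Lambda> n \<omega>) * 1"
        unfolding p_def by (intro mult_left_mono m.emeasure_le_1) auto
      then have "1 * (ennreal (\<Lambda> n \<omega>) * p + (ennreal (\<Lambda> n \<omega>) * p)\<^sup>2) \<le> ennreal (\<Lambda> n \<omega>) + (ennreal (\<Lambda> n \<omega>))\<^sup>2"
        by (simp add: add_mono power_mono)
      then show "1 * (ennreal (\<Lambda> n \<omega>) * emeasure m (\<Union>(free_cells n k \<omega>)) + (ennreal (\<Lambda> n \<omega>) * emeasure m (\<Union>(free_cells n k \<omega>)))\<^sup>2)
          \<le> ennreal (\<Lambda> n \<omega> + (\<Lambda> n \<omega>)\<^sup>2)"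
        using Lam_pos[OF \<omega>, of n] by (simp add: p_def[symmetric] ennreal_power)
    qed
    finally show "(\<integral>\<^sup>+\<omega>. (emeasure (Ms (Suc n) \<omega>) (\<Union>(free_cells n k \<omega>)))\<^sup>2 \<partial>P) \<le> (\<integral>\<^sup>+\<omega>. ennreal (\<Lambda> n \<omega> + (\<Lambda> n \<omega>)\<^sup>2) \<partial>P)" .
  qed
  finally show ?thesis .
qed

end

section \<open>Almost sure growth of the number of features\<close>

lemma integrable_mult_of_squares:
  fixes f g :: "'a \<Rightarrow> real"
  assumes [measurable]: "f \<in> borel_measurable M" "g \<in> borel_measurable M"
    and "integrable M (\<lambda>x. (f x)\<^sup>2)" "integrable M (\<lambda>x. (g x)\<^sup>2)"
  shows "integrable M (\<lambda>x. f x * g x)"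
proof (rule Bochner_Integration.integrable_bound)
  show "integrable M (\<lambda>x. (f x)\<^sup>2 + (g x)\<^sup>2)" using assms by auto
  have "\<bar>a * b\<bar> \<le> a\<^sup>2 + b\<^sup>2" for a b :: real
  proof -
    have "0 \<le> \<bar>a * b\<bar>" by simp
    moreover have "2 * \<bar>a * b\<bar> \<le> a\<^sup>2 + b\<^sup>2"
      using sum_squares_bound[of "\<bar>a\<bar>" "\<bar>b\<bar>"] by (simp add: abs_mult)
    ultimately show ?thesis by linarith
  qed
  then show "AE x in M. norm (f x * g x) \<le> norm ((f x)\<^sup>2 + (g x)\<^sup>2)" by simp
qed measurable

context weighted_buffet
begin

text \<open>Deterministic majorant of \<Lambda>_n: the sum of the weights is replaced by its lower
  bound n u, and 1 + 1 / (c + \<beta>) bounds the correction factor of \<open>Gamma_ratio_le\<close>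
  for all x >= c + \<beta>.\<close>

definition Lam_bound :: "nat \<Rightarrow> real" where
  "Lam_bound n = \<alpha> * Gamma (c + 1) / Gamma (c + \<beta>) * (1 + 1 / (c + \<beta>)) * (c + \<beta> + real n * u) powr (\<beta> - 1)"

lemma Lam_le:
  assumes \<omega>: "\<omega> \<in> space P"
  shows "\<Lambda> n \<omega> \<le> Lam_bound n"
proof -
  define x where "x = c + \<beta> + (\<Sum>i=1..n. R i \<omega>)"
  have x0: "0 < c + \<beta>" using c by simp
  have le: "c + \<beta> + real n * u \<le> x" using weight_sum_ge[OF \<omega>, of n] by (simp add: x_def)
  have pos: "0 < c + \<beta> + real n * u" using add_pos_nonneg[OF x0 mult_nonneg_nonneg[of "real n" u]] u by simp
  have xge: "c + \<beta> \<le> x" using weight_sum_nonneg[OF \<omega>, of n] by (simp add: x_def)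
  have x: "0 < x" using xge x0 by linarith
  have "Gamma x / Gamma (x + (1 - \<beta>)) \<le> (1 + (1 - \<beta>) / x) powr (1 - (1 - \<beta>)) * x powr (- (1 - \<beta>))"
    using x \<beta> by (intro Gamma_ratio_le) auto
  also have "\<dots> \<le> (1 + 1 / (c + \<beta>)) * (c + \<beta> + real n * u) powr (\<beta> - 1)"
  proof (intro mult_mono)
    have "(1 + (1 - \<beta>) / x) powr (1 - (1 - \<beta>)) \<le> (1 + (1 - \<beta>) / x) powr 1"
      using x \<beta> by (intro powr_mono) auto
    also have "\<dots> = 1 + (1 - \<beta>) / x" using x \<beta> by (simp add: add_pos_nonneg)
    also have "\<dots> \<le> 1 + 1 / (c + \<beta>)" using x x0 \<beta> xge by (intro add_left_mono frac_le) auto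
    finally show "(1 + (1 - \<beta>) / x) powr (1 - (1 - \<beta>)) \<le> 1 + 1 / (c + \<beta>)" .
    show "x powr (- (1 - \<beta>)) \<le> (c + \<beta> + real n * u) powr (\<beta> - 1)"
      using powr_mono2'[of "\<beta> - 1" "c + \<beta> + real n * u" x] pos le \<beta> by simp
  qed (use x0 in auto)
  finally have "\<alpha> * Gamma (c + 1) / Gamma (c + \<beta>) * (Gamma x / Gamma (x + (1 - \<beta>)))
     \<le> \<alpha> * Gamma (c + 1) / Gamma (c + \<beta>) * ((1 + 1 / (c + \<beta>)) * (c + \<beta> + real n * u) powr (\<beta> - 1))"
    using \<alpha> x0 \<beta> by (intro mult_left_mono) (auto intro!: divide_nonneg_nonneg mult_nonneg_nonneg less_imp_le[OF Gamma_real_pos])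
  then show ?thesis by (simp add: Lam_eq Lam_bound_def x_def mult.assoc)
qed

text \<open>The quotients converge and are therefore bounded; where the scale is 0 they are 0 by
  convention.\<close>

lemma sum_Lam_bound: "\<exists>C\<ge>0. \<forall>n. (\<Sum>j<n. Lam_bound j) / growth \<beta> n \<le> C"
proof -
  define K where "K = \<alpha> * Gamma (c + 1) / Gamma (c + \<beta>) * (1 + 1 / (c + \<beta>))"
  have "(\<lambda>n. (c + \<beta>) / real n + u) \<longlonglongrightarrow> 0 + u"
    by (intro tendsto_add tendsto_const) real_asymp
  then have "(\<lambda>n. ((c + \<beta>) / real n + u) powr (\<beta> - 1)) \<longlonglongrightarrow> u powr (\<beta> - 1)"
    using u by (intro tendsto_powr) auto
  moreover have "\<forall>\<^sub>F n in sequentially. ((c + \<beta>) / real n + u) powr (\<beta> - 1) = (c + \<beta> + real n * u) powr (\<beta> - 1) / real n powr (\<beta> - 1)"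
    using eventually_gt_at_top[of 0]
  proof eventually_elim
    case (elim n)
    have "(c + \<beta>) / real n + u = (c + \<beta> + real n * u) / real n" using elim by (simp add: field_simps)
    then show ?case using c u elim by (simp add: powr_divide)
  qed
  ultimately have "(\<lambda>n. (c + \<beta> + real n * u) powr (\<beta> - 1) / real n powr (\<beta> - 1)) \<longlonglongrightarrow> u powr (\<beta> - 1)"
    by (rule Lim_transform_eventually)
  from tendsto_mult[OF tendsto_const[of K] this]
  have "(\<lambda>n. Lam_bound n / real n powr (\<beta> - 1)) \<longlonglongrightarrow> K * u powr (\<beta> - 1)"
    by (simp add: Lam_bound_def K_def)
  then have "convergent (\<lambda>n. (\<Sum>j<n. Lam_bound j) / growth \<beta> n)"
    by (rule convergentI[OF sum_powr_growth[OF \<beta>]])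
  then obtain C where C: "\<And>n. norm ((\<Sum>j<n. Lam_bound j) / growth \<beta> n) \<le> C"
    using BseqE[OF convergent_imp_Bseq] by blast
  have "(\<Sum>j<n. Lam_bound j) / growth \<beta> n \<le> C" for n
    using C[of n] unfolding real_norm_def abs_le_iff by simp
  moreover have "0 \<le> C" using order_trans[OF norm_ge_zero C] .
  ultimately show ?thesis by blast
qed

lemma integrable_Lam: "integrable P (\<Lambda> n)" "integrable P (\<lambda>\<omega>. (\<Lambda> n \<omega>)\<^sup>2)"
proof -
  have b: "norm (\<Lambda> n \<omega>) \<le> Lam_bound n" if "\<omega> \<in> space P" for \<omega>
    using Lam_le[OF that, of n] Lam_pos[OF that, of n] by simp
  then show "integrable P (\<Lambda> n)" by (intro P.integrable_const_bound[of _ "Lam_bound n"]) auto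
  show "integrable P (\<lambda>\<omega>. (\<Lambda> n \<omega>)\<^sup>2)"
    by (intro P.integrable_const_bound[of _ "(Lam_bound n)\<^sup>2"] AE_I2, unfold norm_power)
       (intro power_mono b, auto)
qed

lemma integrable_new_mass_square: "integrable P (\<lambda>\<omega>. (new_mass n \<omega>)\<^sup>2)"
    and expectation_new_mass_square:
      "(\<integral>\<omega>. (new_mass n \<omega>)\<^sup>2 \<partial>P) \<le> (\<integral>\<omega>. \<Lambda> n \<omega> \<partial>P) + (\<integral>\<omega>. (\<Lambda> n \<omega>)\<^sup>2 \<partial>P)"
proof -
  have L: "integrable P (\<lambda>\<omega>. \<Lambda> n \<omega> + (\<Lambda> n \<omega>)\<^sup>2)" using integrable_Lam by auto
  have nn: "AE \<omega> in P. 0 \<le> \<Lambda> n \<omega> + (\<Lambda> n \<omega>)\<^sup>2" using Lam_pos by (intro AE_I2) (simp add: less_imp_le)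
  have bound: "(\<integral>\<^sup>+\<omega>. ennreal ((new_mass n \<omega>)\<^sup>2) \<partial>P) \<le> ennreal (\<integral>\<omega>. \<Lambda> n \<omega> + (\<Lambda> n \<omega>)\<^sup>2 \<partial>P)"
    using new_mass_second_moment[of n] nn_integral_eq_integral[OF L nn] by simp
  then show Z: "integrable P (\<lambda>\<omega>. (new_mass n \<omega>)\<^sup>2)"
    by (intro integrableI_bounded) (auto simp: le_less_trans)
  have "ennreal (\<integral>\<omega>. (new_mass n \<omega>)\<^sup>2 \<partial>P) \<le> ennreal (\<integral>\<omega>. \<Lambda> n \<omega> + (\<Lambda> n \<omega>)\<^sup>2 \<partial>P)"
    using bound nn_integral_eq_integral[OF Z] by simp
  moreover have "0 \<le> (\<integral>\<omega>. \<Lambda> n \<omega> + (\<Lambda> n \<omega>)\<^sup>2 \<partial>P)" using nn by (rule integral_nonneg_AE)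
  ultimately show "(\<integral>\<omega>. (new_mass n \<omega>)\<^sup>2 \<partial>P) \<le> (\<integral>\<omega>. \<Lambda> n \<omega> \<partial>P) + (\<integral>\<omega>. (\<Lambda> n \<omega>)\<^sup>2 \<partial>P)"
    using integrable_Lam by (simp add: ennreal_le_iff)
qed

lemma integrable_new_mass: "integrable P (new_mass n)"
  using P.square_integrable_imp_integrable[OF new_mass_measurable integrable_new_mass_square] .

lemma cond_exp_new_mass: "AE \<omega> in P. real_cond_exp P (\<F> n) (new_mass n) \<omega> = \<Lambda> n \<omega>"
proof (rule filtr.real_cond_exp_charact[OF _ integrable_new_mass integrable_Lam(1) Lam_adapted])
  fix A assume A: "A \<in> sets (\<F> n)"
  then have [measurable]: "A \<in> sets P" using subalgebra_filtration[of n] by (auto simp: subalgebra_def)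
  have "(\<integral>\<^sup>+\<omega>. ennreal (indicator A \<omega> * new_mass n \<omega>) \<partial>P) = (\<integral>\<^sup>+\<omega>. indicator A \<omega> * ennreal (new_mass n \<omega>) \<partial>P)"
    by (intro nn_integral_cong) (simp add: indicator_def)
  also have "\<dots> = (\<integral>\<^sup>+\<omega>. indicator A \<omega> * ennreal (\<Lambda> n \<omega>) \<partial>P)"
    using A by (intro new_mass_first_moment) simp
  also have "\<dots> = (\<integral>\<^sup>+\<omega>. ennreal (indicator A \<omega> * \<Lambda> n \<omega>) \<partial>P)"
    by (intro nn_integral_cong) (simp add: indicator_def)
  finally have eq: "(\<integral>\<^sup>+\<omega>. ennreal (indicator A \<omega> * new_mass n \<omega>) \<partial>P) = (\<integral>\<^sup>+\<omega>. ennreal (indicator A \<omega> * \<Lambda> n \<omega>) \<partial>P)" .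
  have "(\<integral>\<omega>. indicator A \<omega> * new_mass n \<omega> \<partial>P) = enn2real (\<integral>\<^sup>+\<omega>. ennreal (indicator A \<omega> * new_mass n \<omega>) \<partial>P)"
    by (intro integral_eq_nn_integral) (auto simp: new_mass_nonneg)
  moreover have "(\<integral>\<omega>. indicator A \<omega> * \<Lambda> n \<omega> \<partial>P) = enn2real (\<integral>\<^sup>+\<omega>. ennreal (indicator A \<omega> * \<Lambda> n \<omega>) \<partial>P)"
    using Lam_pos by (intro integral_eq_nn_integral AE_I2) (auto simp: less_imp_le)
  ultimately show "(\<integral>\<omega>\<in>A. new_mass n \<omega> \<partial>P) = (\<integral>\<omega>\<in>A. \<Lambda> n \<omega> \<partial>P)"
    using eq by (simp add: set_lebesgue_integral_def)
qed

lemma expectation_mult_new_mass: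
  assumes h: "h \<in> borel_measurable (\<F> n)" and "integrable P (\<lambda>\<omega>. h \<omega> * new_mass n \<omega>)"
  shows "(\<integral>\<omega>. h \<omega> * new_mass n \<omega> \<partial>P) = (\<integral>\<omega>. h \<omega> * \<Lambda> n \<omega> \<partial>P)"
proof -
  have [measurable]: "h \<in> borel_measurable P" by (rule measurable_filtration_P[OF h])
  have "(\<integral>\<omega>. h \<omega> * new_mass n \<omega> \<partial>P) = (\<integral>\<omega>. h \<omega> * real_cond_exp P (\<F> n) (new_mass n) \<omega> \<partial>P)"
    using filtr.real_cond_exp_intg(2)[OF assms(2) h] by simp
  also have "\<dots> = (\<integral>\<omega>. h \<omega> * \<Lambda> n \<omega> \<partial>P)"
    using cond_exp_new_mass[of n] by (intro integral_cong_AE) (auto elim!: eventually_mono)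
  finally show ?thesis .
qed

text \<open>A martingale whose variance at time \<open>n\<close> is at most the expected sum of the \<open>\<Lambda> j\<close>, since the new
  mass at step \<open>j + 1\<close> is conditionally Poisson with parameter \<open>\<Lambda> j\<close>.\<close>
definition compensated :: "nat \<Rightarrow> 'w \<Rightarrow> real" where
  "compensated n \<omega> = (\<Sum>j<n. new_mass j \<omega> - \<Lambda> j \<omega>)"

lemma compensated_adapted: "compensated n \<in> borel_measurable (\<F> n)"
proof -
  have "\<Lambda> j \<in> borel_measurable (\<F> n)" if "j < n" for j
  proof -
    have "sets (\<F> j) \<subseteq> sets (\<F> n)"
      unfolding sets_filtration using that by (intro sigma_sets_mono' Un_mono UN_mono) auto
    then have "subalgebra (\<F> n) (\<F> j)" by (simp add: subalgebra_def)
    then show ?thesis by (rule measurable_from_subalg[OF _ Lam_adapted])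
  qed
  then show ?thesis
    unfolding compensated_def[abs_def] by (intro borel_measurable_sum borel_measurable_diff new_mass_adapted) auto
qed

lemma compensated_measurable [measurable]: "compensated n \<in> borel_measurable P"
  by (rule measurable_filtration_P[OF compensated_adapted])

lemma compensated_second_moment:
  "integrable P (\<lambda>\<omega>. (compensated n \<omega>)\<^sup>2) \<and> (\<integral>\<omega>. (compensated n \<omega>)\<^sup>2 \<partial>P) \<le> (\<Sum>j<n. Lam_bound j)"
proof (induction n)
  case 0
  then show ?case by (simp add: compensated_def)
next
  case (Suc n)
  let ?W = "compensated n" and ?Z = "new_mass n" and ?L = "\<Lambda> n"
  note sq = Suc[THEN conjunct1] integrable_new_mass_square[of n] integrable_Lam(2)[of n]
  have WZ: "integrable P (\<lambda>\<omega>. ?W \<omega> * ?Z \<omega>)" and WL: "integrable P (\<lambda>\<omega>. ?W \<omega> * ?L \<omega>)"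
    and LZ: "integrable P (\<lambda>\<omega>. ?L \<omega> * ?Z \<omega>)"
    using sq by (intro integrable_mult_of_squares; simp)+
  have eq: "(\<lambda>\<omega>. (compensated (Suc n) \<omega>)\<^sup>2) = (\<lambda>\<omega>. (?W \<omega>)\<^sup>2 + 2 * (?W \<omega> * ?Z \<omega>) - 2 * (?W \<omega> * ?L \<omega>)
      + (?Z \<omega>)\<^sup>2 - 2 * (?L \<omega> * ?Z \<omega>) + (?L \<omega>)\<^sup>2)"
    by (rule ext) (simp add: compensated_def power2_eq_square algebra_simps)
  have int: "integrable P (\<lambda>\<omega>. (compensated (Suc n) \<omega>)\<^sup>2)"
    unfolding eq using sq WZ WL LZ by auto
  have "(\<integral>\<omega>. (compensated (Suc n) \<omega>)\<^sup>2 \<partial>P) = (\<integral>\<omega>. (?W \<omega>)\<^sup>2 \<partial>P) + 2 * (\<integral>\<omega>. ?W \<omega> * ?Z \<omega> \<partial>P) - 2 * (\<integral>\<omega>. ?W \<omega> * ?L \<omega> \<partial>P)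
      + (\<integral>\<omega>. (?Z \<omega>)\<^sup>2 \<partial>P) - 2 * (\<integral>\<omega>. ?L \<omega> * ?Z \<omega> \<partial>P) + (\<integral>\<omega>. (?L \<omega>)\<^sup>2 \<partial>P)"
    unfolding eq using sq WZ WL LZ by simp
  \<comment> \<open>W and \<Lambda>_n are known at time n, so Z may be replaced by \<Lambda>_n in
    both products W Z and \<Lambda>_n Z. The terms with W to the first power cancel, and the mean of
    \<Lambda>_n^2 remains with coefficient -2 + 1 = -1, which the second moment of Z
    compensates.\<close>
  also have "\<dots> = (\<integral>\<omega>. (?W \<omega>)\<^sup>2 \<partial>P) + (\<integral>\<omega>. (?Z \<omega>)\<^sup>2 \<partial>P) - (\<integral>\<omega>. (?L \<omega>)\<^sup>2 \<partial>P)"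
    using expectation_mult_new_mass[OF compensated_adapted WZ] expectation_mult_new_mass[OF Lam_adapted LZ]
    by (simp add: power2_eq_square)
  also have "\<dots> \<le> (\<integral>\<omega>. (?W \<omega>)\<^sup>2 \<partial>P) + (\<integral>\<omega>. ?L \<omega> \<partial>P)"
    using expectation_new_mass_square[of n] by simp
  also have "(\<integral>\<omega>. ?L \<omega> \<partial>P) \<le> (\<integral>\<omega>. Lam_bound n \<partial>P)"
    using Lam_le by (intro integral_mono integrable_Lam) auto
  finally show ?case using int Suc by (simp add: P.prob_space)
qed

text \<open>The squared quotients along the levels have summable expectations, so their sum is
  almost surely finite and its terms tend to 0.\<close>

lemma AE_compensated_levels:
  "AE \<omega> in P. (\<lambda>k. compensated (square_level (growth \<beta>) k) \<omega> / growth \<beta> (square_level (growth \<beta>) k)) \<longlonglongrightarrow> 0"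
proof -
  obtain C where C: "C \<ge> 0" "\<And>n. (\<Sum>j<n. Lam_bound j) / growth \<beta> n \<le> C"
    using sum_Lam_bound by blast
  \<comment> \<open>Starting at level 1 keeps the scale at least 1 at every index used; the shift is
    undone at the end.\<close>
  define N where "N k = square_level (growth \<beta>) (Suc k)" for k
  define Y where "Y k \<omega> = (compensated (N k) \<omega> / growth \<beta> (N k))\<^sup>2" for k \<omega>
  have [measurable]: "Y k \<in> borel_measurable P" for k unfolding Y_def by measurable
  have bound: "(\<integral>\<^sup>+\<omega>. ennreal (Y k \<omega>) \<partial>P) \<le> ennreal (C * (1 / (real (Suc k))\<^sup>2))" for k
  proof -
    define a where "a = growth \<beta> (N k)"
    have a: "(real (Suc k))\<^sup>2 \<le> a" unfolding a_def N_def by (rule square_level_ge[OF growth_at_top[OF \<beta>]])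
    have a_pos: "0 < a" using a by (rule less_le_trans[rotated]) simp
    have int: "integrable P (Y k)"
      unfolding Y_def power_divide using compensated_second_moment[of "N k"] by auto
    have "(\<integral>\<omega>. Y k \<omega> \<partial>P) = (\<integral>\<omega>. (compensated (N k) \<omega>)\<^sup>2 \<partial>P) / a\<^sup>2"
      unfolding Y_def power_divide by (simp add: a_def)
    also have "\<dots> \<le> (\<Sum>j<N k. Lam_bound j) / a\<^sup>2"
      using compensated_second_moment[of "N k"] by (intro divide_right_mono) auto
    \<comment> \<open>One factor of the squared scale absorbs the variance, and the other is at
      least (k + 1)^2.\<close>
    also have "\<dots> = ((\<Sum>j<N k. Lam_bound j) / growth \<beta> (N k)) / a" by (simp add: a_def power2_eq_square)
    also have "\<dots> \<le> C / a" using C(2) a_pos by (intro divide_right_mono) auto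
    also have "\<dots> \<le> C / (real (Suc k))\<^sup>2" using C(1) a a_pos by (intro divide_left_mono) auto
    finally have "(\<integral>\<omega>. Y k \<omega> \<partial>P) \<le> C * (1 / (real (Suc k))\<^sup>2)" by simp
    moreover have "(\<integral>\<^sup>+\<omega>. ennreal (Y k \<omega>) \<partial>P) = ennreal (\<integral>\<omega>. Y k \<omega> \<partial>P)"
      by (rule nn_integral_eq_integral[OF int]) (simp add: Y_def)
    ultimately show ?thesis by (simp add: ennreal_leI)
  qed
  have summ: "summable (\<lambda>k. C * (1 / (real (Suc k))\<^sup>2))"
    using inverse_squares_sums by (intro summable_mult) (simp add: sums_iff add.commute)
  have "(\<integral>\<^sup>+\<omega>. (\<Sum>k. ennreal (Y k \<omega>)) \<partial>P) = (\<Sum>k. \<integral>\<^sup>+\<omega>. ennreal (Y k \<omega>) \<partial>P)"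
    by (intro nn_integral_suminf) measurable
  also have "\<dots> \<le> (\<Sum>k. ennreal (C * (1 / (real (Suc k))\<^sup>2)))"
    using bound by (intro suminf_le) auto
  also have "\<dots> < \<infinity>" using C(1) summ by (subst suminf_ennreal2) auto
  finally have "AE \<omega> in P. (\<Sum>k. ennreal (Y k \<omega>)) \<noteq> \<infinity>"
    by (intro nn_integral_PInf_AE) auto
  then show ?thesis
  proof eventually_elim
    case (elim \<omega>)
    have "summable (\<lambda>k. Y k \<omega>)" using elim by (intro summable_suminf_not_top) (auto simp: Y_def)
    then have "(\<lambda>k. sqrt (Y k \<omega>)) \<longlonglongrightarrow> sqrt 0" by (intro tendsto_real_sqrt summable_LIMSEQ_zero)
    then have "(\<lambda>k. compensated (N k) \<omega> / growth \<beta> (N k)) \<longlonglongrightarrow> 0"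
      unfolding Y_def real_sqrt_abs by (simp only: real_sqrt_zero tendsto_rabs_zero_iff)
    then show ?case unfolding N_def by (rule LIMSEQ_imp_Suc)
  qed
qed

lemma sum_Lam_asymp:
  assumes \<omega>: "\<omega> \<in> space P" and lim: "(\<lambda>n. (\<Sum>i=1..n. R i \<omega>) / real n) \<longlonglongrightarrow> r"
  shows "(\<lambda>n. (\<Sum>j<n. \<Lambda> j \<omega>) / growth \<beta> n) \<longlonglongrightarrow>
    (if \<beta> = 0 then \<alpha> * c / r else \<alpha> * Gamma (c + 1) / Gamma (c + \<beta>) * (1 / (\<beta> * r powr (1 - \<beta>))))"
proof -
  define K where "K = \<alpha> * Gamma (c + 1) / Gamma (c + \<beta>)"
  \<comment> \<open>All averages are at least u, which forces r >= u > 0, as the power of r in the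
    limit requires.\<close>
  have "u \<le> r"
  proof (rule tendsto_lowerbound[OF lim])
    show "\<forall>\<^sub>F n in sequentially. u \<le> (\<Sum>i=1..n. R i \<omega>) / real n"
      using eventually_gt_at_top[of 0]
      by eventually_elim (use weight_sum_ge[OF \<omega>] in \<open>simp add: field_simps\<close>)
  qed simp
  then have r: "r > 0" using u by simp
  have "(\<lambda>n. (Gamma (c + \<beta> + (\<Sum>i=1..n. R i \<omega>)) / Gamma (c + \<beta> + (\<Sum>i=1..n. R i \<omega>) + (1 - \<beta>))) / real n powr (- (1 - \<beta>)))
    \<longlonglongrightarrow> r powr (- (1 - \<beta>))"
    using \<beta> r lim by (intro Gamma_ratio_along_linear) auto
  from tendsto_mult[OF tendsto_const[of K] this]
  have "(\<lambda>n. \<Lambda> n \<omega> / real n powr (\<beta> - 1)) \<longlonglongrightarrow> K * r powr (\<beta> - 1)"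
    by (simp add: Lam_eq K_def mult.assoc)
  then have "(\<lambda>n. (\<Sum>j<n. \<Lambda> j \<omega>) / growth \<beta> n) \<longlonglongrightarrow> K * r powr (\<beta> - 1) * (if \<beta> = 0 then 1 else 1 / \<beta>)"
    by (rule sum_powr_growth[OF \<beta>])
  also have "K * r powr (\<beta> - 1) * (if \<beta> = 0 then 1 else 1 / \<beta>) =
    (if \<beta> = 0 then \<alpha> * c / r else \<alpha> * Gamma (c + 1) / Gamma (c + \<beta>) * (1 / (\<beta> * r powr (1 - \<beta>))))"
  proof (cases "\<beta> = 0")
    case True
    \<comment> \<open>For \<beta> = 0 the condition c > -\<beta> reads c > 0, and the quotient Gamma
      (c + 1) / Gamma c = c produces the constant.\<close>
    then have "0 < c" using c by simp
    then have "Gamma (c + 1) = c * Gamma c" using pos_not_nonpos_Int by (intro Gamma_plus1) auto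
    moreover have "Gamma c > 0" using \<open>0 < c\<close> by (rule Gamma_real_pos)
    ultimately show ?thesis using True r by (simp add: K_def powr_minus field_simps)
  next
    case False
    have "r powr (\<beta> - 1) = 1 / r powr (1 - \<beta>)" using r powr_minus_divide[of r "1 - \<beta>"] by simp
    with False show ?thesis by (simp add: K_def)
  qed
  finally show ?thesis .
qed

lemma AE_card_S_asymp:
  assumes "AE \<omega> in P. (\<lambda>n. (\<Sum>i=1..n. R i \<omega>) / real n) \<longlonglongrightarrow> r"
  shows "AE \<omega> in P. (\<lambda>n. real (card (S n \<omega>)) / growth \<beta> n) \<longlonglongrightarrow>
    (if \<beta> = 0 then \<alpha> * c / r else \<alpha> * Gamma (c + 1) / Gamma (c + \<beta>) * (1 / (\<beta> * r powr (1 - \<beta>))))"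
    (is "AE \<omega> in P. _ \<longlonglongrightarrow> ?l")
  using assms AE_compensated_levels AE_simple AE_space
proof eventually_elim
  case (elim \<omega>)
  let ?a = "growth \<beta>"
  let ?N = "square_level ?a"
  obtain D where D: "D \<ge> 0" "\<And>n. ?a (Suc n) \<le> ?a n + D" using growth_diff_bounded[OF \<beta>] by blast
  \<comment> \<open>The number of features is the martingale plus its compensator; divided by the
    scale, these tend to 0 and to the stated constant.\<close>
  have "(\<lambda>k. compensated (?N k) \<omega> / ?a (?N k) + (\<Sum>j<?N k. \<Lambda> j \<omega>) / ?a (?N k)) \<longlonglongrightarrow> 0 + ?l"
    by (intro tendsto_add elim(2) filterlim_compose[OF sum_Lam_asymp[OF elim(4,1)]
          square_level_at_top[OF growth_at_top[OF \<beta>] incseq_growth[OF \<beta>]]])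
  then have "(\<lambda>k. real (card (S (?N k) \<omega>)) / ?a (?N k)) \<longlonglongrightarrow> ?l"
    by (simp add: card_S_eq[OF elim(4,3)] compensated_def sum_subtractf add_divide_distrib[symmetric])
  moreover have "incseq (\<lambda>n. real (card (S n \<omega>)))"
    using new_mass_nonneg by (intro incseq_SucI) (simp add: card_S_eq[OF elim(4,3)])
  ultimately show ?case
    using tendsto_from_square_levels[OF growth_at_top[OF \<beta>] growth_0 incseq_growth[OF \<beta>] D(2,1)] \<beta> by simp
qed

end

theorem theorem4:
  fixes P :: "'w measure"
    and m :: "'x::{metric_space, second_countable_topology} measure"
    and Ms :: "nat \<Rightarrow> 'w \<Rightarrow> 'x measure"
    and R :: "nat \<Rightarrow> 'w \<Rightarrow> real"
    and \<alpha> \<beta> c u r :: real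
  assumes P: "prob_space P"
    and m_prob: "prob_space m" and m_sets: "sets m = sets borel"
    and m_diffuse: "\<And>x. emeasure m {x} = 0"
    and \<alpha>: "\<alpha> > 0" and \<beta>: "0 \<le> \<beta>" "\<beta> < 1" and c: "c > - \<beta>"
    and M_rm: "\<And>n. n \<ge> 1 \<Longrightarrow> random_measure P (Ms n)"
    and R_meas: "\<And>n. n \<ge> 1 \<Longrightarrow> R n \<in> borel_measurable P"
    and R_indep: "\<And>n. n \<ge> 1 \<Longrightarrow>
          prob_space.indep_set P {R n -` A \<inter> space P | A. A \<in> sets borel}
            (sets (gen_sigma P Ms R {1..n} {1..n - 1}))"
    and u: "u > max \<beta> 0" and R_ge: "\<And>n \<omega>. n \<ge> 1 \<Longrightarrow> \<omega> \<in> space P \<Longrightarrow> R n \<omega> \<ge> u"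
    and BeP_step: "\<And>n. cond_BeP P (gen_sigma P Ms R {1..n} {1..n})
                           (Ms (Suc n)) (hazard m \<alpha> \<beta> c Ms R n)"
    and Rbar: "AE \<omega> in P. (\<lambda>n. (\<Sum>i=1..n. R i \<omega>) / real n) \<longlonglongrightarrow> r"
  shows "AE \<omega> in P.
           (\<lambda>n. real (card (feat_set Ms n \<omega>)) /
                 (if \<beta> = 0 then ln (real n) else real n powr \<beta>))
           \<longlonglongrightarrow> (if \<beta> = 0 then \<alpha> * c / r
               else \<alpha> * Gamma (c + 1) / Gamma (c + \<beta>) * (1 / (\<beta> * r powr (1 - \<beta>))))"
proof -
  interpret weighted_buffet P m Ms R \<alpha> \<beta> c u
    by (rule weighted_buffet.intro) (fact P m_prob m_sets m_diffuse \<alpha> \<beta> c M_rm R_meas u R_ge BeP_step)+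
  show ?thesis using AE_card_S_asymp[OF Rbar] unfolding growth_def .
qed

end
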